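(* Let $\{r_n\}_{n\ge 1}$ be a sequence of positive integers with $\sum_{n=1}^\infty \frac1{r_n}<\infty$, let $G$ be the associated $2$-dimensional solenoid, let $\rho$ be the Haar probability measure on $G$, and let $H\subset G$ be the canonical dense subgroup isomorphic to $\mathbb{R}^2\cong\mathbb{C}$. Then there is a measurable function $F:G\to\mathbb{C}$ whose restriction to $\rho$-almost every coset of $H$ is an entire function with a dense orbit under the translation action of $\mathbb{C}$ on $\mathcal{E}$; that is, for $\rho$-a.e. $g\in G$ the function $\hat F(g):\mathbb{C}\to\mathbb{C}$, $\hat F(g)(z)=F(g+z)$, belongs to $\mathcal{U}$. Moreover, the push-forward $\mu$ of $\rho$ under the ($\rho$-a.e. defined) map $\hat F:G\to\mathcal{E}$ is an ergodic measure on $\mathcal{E}$ for the translation action of $\mathbb{C}$, and $\mu$-a.e. $f$ belongs to $\mathcal{U}$.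
   Context: $\mathcal{E}$ is the space of entire functions $f:\mathbb{C}\to\mathbb{C}$ with the topology of uniform convergence on compact sets (a Polish space). The translation action of $\mathbb{C}$ on $\mathcal{E}$ is $T_zf(w)=f(w+z)$. $\mathcal{U}\subset\mathcal{E}$ is the set of entire functions $f$ whose orbit $\{T_zf: z\in\mathbb{C}\}$ is dense in $\mathcal{E}$. An ergodic measure is an invariant ergodic Borel probability measure. Solenoid: given a sequence of positive integers $\{r_n\}$, put $R_n=\prod_{i=1}^n r_i$. The $2$-dimensional solenoid $G$ is the inverse limit of the compact abelian groups $\mathbb{R}^2/R_n\mathbb{Z}^2$ along the natural homomorphisms $\mathbb{R}^2/R_{n+1}\mathbb{Z}^2\to\mathbb{R}^2/R_n\mathbb{Z}^2$. It is a compact abelian group. The diagonal homomorphism $\mathbb{R}^2\to G$, $t\mapsto (t \bmod R_n\mathbb{Z}^2)_{n\ge1}$, is injective with dense image $H$; identifying $\mathbb{R}^2$ with $\mathbb{C}$, one identifies $H$ with $\mathbb{C}$, and for $g\in G$, $z\in\mathbb{C}$, $g+z$ denotes the sum in $G$ of $g$ and the element of $H$ corresponding to $z$. *)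

theory Defs
  imports
    "HOL-Complex_Analysis.Complex_Analysis"
    "HOL-Probability.Probability"
    "HOL-Algebra.Product_Groups"
begin

definition borel_of_topology :: "'a topology \<Rightarrow> 'a measure" where
  "borel_of_topology X = sigma (topspace X) {U. openin X U}"

text \<open>The space of entire functions with uniform convergence on compact sets.\<close>

definition entire_functions :: "(complex \<Rightarrow> complex) set" where
  "entire_functions = {f. f holomorphic_on UNIV}"

definition entire_topology :: "(complex \<Rightarrow> complex) topology" where
  "entire_topology = topology (\<lambda>U. U \<subseteq> entire_functions \<and>
     (\<forall>f\<in>U. \<exists>K e. compact K \<and> e > 0 \<and>
        {g \<in> entire_functions. \<forall>z\<in>K. dist (f z) (g z) < e} \<subseteq> U))"

lemma openin_entire_topology:
  "openin entire_topology U \<longleftrightarrow> U \<subseteq> entire_functions \<and>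
     (\<forall>f\<in>U. \<exists>K e. compact K \<and> e > 0 \<and>
        {g \<in> entire_functions. \<forall>z\<in>K. dist (f z) (g z) < e} \<subseteq> U)"
proof -
  define N where "N f K e = {g \<in> entire_functions. \<forall>z\<in>K. dist (f z) (g z) < e}"
    for f :: "complex \<Rightarrow> complex" and K and e :: real
  define P where "P U \<longleftrightarrow> U \<subseteq> entire_functions \<and> (\<forall>f\<in>U. \<exists>K e. compact K \<and> e > 0 \<and> N f K e \<subseteq> U)" for U
  have "istopology P"
    unfolding istopology_def
  proof (intro conjI allI impI)
    fix S T assume S: "P S" and T: "P T"
    show "P (S \<inter> T)"
      unfolding P_def
    proof (intro conjI ballI)
      show "S \<inter> T \<subseteq> entire_functions" using S by (auto simp: P_def)
      fix f assume f: "f \<in> S \<inter> T"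
      obtain K d where 1: "compact K" "d > 0" "N f K d \<subseteq> S" using S f unfolding P_def by blast
      obtain L e where 2: "compact L" "e > 0" "N f L e \<subseteq> T" using T f unfolding P_def by blast
      have "N f (K \<union> L) (min d e) \<subseteq> S \<inter> T"
        using 1(3) 2(3) unfolding N_def by fastforce
      then show "\<exists>K e. compact K \<and> e > 0 \<and> N f K e \<subseteq> S \<inter> T"
        using 1 2 by (intro exI[of _ "K \<union> L"] exI[of _ "min d e"]) auto
    qed
  next
    fix \<K> assume "\<forall>K\<in>\<K>. P K"
    then show "P (\<Union>\<K>)" unfolding P_def by (meson Sup_least UnionE Union_upper subset_trans)
  qed
  then show ?thesis
    unfolding entire_topology_def P_def N_def by (simp add: topology_inverse')
qed

definition translate :: "complex \<Rightarrow> (complex \<Rightarrow> complex) \<Rightarrow> (complex \<Rightarrow> complex)" where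
  "translate z f = (\<lambda>w. f (w + z))"

definition universal_entire :: "(complex \<Rightarrow> complex) set" where
  "universal_entire = {f \<in> entire_functions.
     entire_topology closure_of (range (\<lambda>z. translate z f)) = topspace entire_topology}"

definition entire_borel :: "(complex \<Rightarrow> complex) measure" where
  "entire_borel = borel_of_topology entire_topology"

text \<open>Ergodicity is tested on Borel sets that are invariant modulo null sets under every
  translation; this includes the strictly invariant sets.\<close>

definition ergodic_measure :: "(complex \<Rightarrow> complex) measure \<Rightarrow> bool" where
  "ergodic_measure \<mu> \<longleftrightarrow>
     prob_space \<mu> \<and> sets \<mu> = sets entire_borel \<and>
     (\<forall>z. translate z \<in> measurable \<mu> \<mu> \<and> distr \<mu> \<mu> (translate z) = \<mu>) \<and>
     (\<forall>A\<in>sets \<mu>.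
        (\<forall>z. emeasure \<mu> (sym_diff (translate z -` A \<inter> space \<mu>) A) = 0) \<longrightarrow>
        emeasure \<mu> A = 0 \<or> emeasure \<mu> A = 1)"

text \<open>The solenoid. The plane is modelled by the type \<^typ>\<open>complex\<close>, so that
  \<open>R\<^sub>n \<int>\<^sup>2\<close> is the lattice of Gaussian integers scaled by \<open>R\<^sub>n\<close>. A point of the quotient
  by it is a coset. Only the values of \<open>r\<close> at indices \<open>\<ge> 1\<close> are used.\<close>

definition plane_group :: "complex monoid" where
  "plane_group = \<lparr>carrier = UNIV, mult = (+), one = 0\<rparr>"

definition R_prod :: "(nat \<Rightarrow> nat) \<Rightarrow> nat \<Rightarrow> nat" where
  "R_prod r n = (\<Prod>i=1..n. r i)"

definition scaled_lattice :: "(nat \<Rightarrow> nat) \<Rightarrow> nat \<Rightarrow> complex set" where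
  "scaled_lattice r n = {of_nat (R_prod r n) * Complex (of_int a) (of_int b) | a b :: int. True}"

definition torus :: "(nat \<Rightarrow> nat) \<Rightarrow> nat \<Rightarrow> complex set monoid" where
  "torus r n = plane_group Mod scaled_lattice r n"

definition torus_proj :: "(nat \<Rightarrow> nat) \<Rightarrow> nat \<Rightarrow> complex \<Rightarrow> complex set" where
  "torus_proj r n z = scaled_lattice r n #>\<^bsub>plane_group\<^esub> z"

text \<open>The quotient topology.\<close>

definition torus_topology :: "(nat \<Rightarrow> nat) \<Rightarrow> nat \<Rightarrow> complex set topology" where
  "torus_topology r n = topology (\<lambda>U. U \<subseteq> carrier (torus r n) \<and> open (torus_proj r n -` U))"

lemma openin_torus_topology:
  "openin (torus_topology r n) U \<longleftrightarrow> U \<subseteq> carrier (torus r n) \<and> open (torus_proj r n -` U)"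
proof -
  have "istopology (\<lambda>U. U \<subseteq> carrier (torus r n) \<and> open (torus_proj r n -` U))"
    unfolding istopology_def by (auto simp: vimage_Int vimage_Union)
  then show ?thesis
    unfolding torus_topology_def by (simp add: topology_inverse')
qed

text \<open>The natural homomorphism from level \<open>n + 1\<close> to level \<open>n\<close> sends the coset of \<open>x\<close> to the
  coset of \<open>x\<close>, that is, it adds the coarser lattice.\<close>

definition torus_bond :: "(nat \<Rightarrow> nat) \<Rightarrow> nat \<Rightarrow> complex set \<Rightarrow> complex set" where
  "torus_bond r n C = scaled_lattice r n <#>\<^bsub>plane_group\<^esub> C"

definition solenoid :: "(nat \<Rightarrow> nat) \<Rightarrow> (nat \<Rightarrow> complex set) monoid" where
  "solenoid r = (product_group {1..} (torus r))
     \<lparr>carrier := {g \<in> carrier (product_group {1..} (torus r)).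
        \<forall>n\<ge>1. torus_bond r n (g (Suc n)) = g n}\<rparr>"

definition solenoid_topology :: "(nat \<Rightarrow> nat) \<Rightarrow> (nat \<Rightarrow> complex set) topology" where
  "solenoid_topology r =
     subtopology (product_topology (torus_topology r) {1..}) (carrier (solenoid r))"

text \<open>The canonical homomorphism of the plane onto the dense subgroup \<open>H\<close>.\<close>

definition solenoid_diag :: "(nat \<Rightarrow> nat) \<Rightarrow> complex \<Rightarrow> (nat \<Rightarrow> complex set)" where
  "solenoid_diag r z = (\<lambda>n\<in>{1..}. torus_proj r n z)"

text \<open>The Haar probability measure of a compact (metrizable) group, characterised by
  invariance.\<close>

definition haar_probability ::
    "('a, 'b) monoid_scheme \<Rightarrow> 'a topology \<Rightarrow> 'a measure \<Rightarrow> bool" where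
  "haar_probability G X \<rho> \<longleftrightarrow>
     prob_space \<rho> \<and> sets \<rho> = sets (borel_of_topology X) \<and>
     (\<forall>g\<in>carrier G. \<forall>A\<in>sets \<rho>. emeasure \<rho> (g <#\<^bsub>G\<^esub> A) = emeasure \<rho> A)"

definition orbit_map ::
    "(nat \<Rightarrow> nat) \<Rightarrow> ((nat \<Rightarrow> complex set) \<Rightarrow> complex) \<Rightarrow> (nat \<Rightarrow> complex set) \<Rightarrow> (complex \<Rightarrow> complex)"
  where "orbit_map r F g = (\<lambda>z. F (g \<otimes>\<^bsub>solenoid r\<^esub> solenoid_diag r z))"

text \<open>\<open>\<nu>\<close> is the push-forward of \<open>M\<close> to \<open>N\<close> under the almost everywhere defined map \<open>f\<close>:
  \<open>f\<close> agrees almost everywhere with a measurable map \<open>h\<close> into \<open>N\<close>, and \<open>\<nu>\<close> is the image of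
  \<open>M\<close> under \<open>h\<close>, which does not depend on the choice of \<open>h\<close>.\<close>

definition is_pushforward_ae :: "'a measure \<Rightarrow> 'b measure \<Rightarrow> ('a \<Rightarrow> 'b) \<Rightarrow> 'b measure \<Rightarrow> bool" where
  "is_pushforward_ae M N f \<nu> \<longleftrightarrow>
     (\<exists>h \<in> measurable M N. (AE x in M. h x = f x) \<and> \<nu> = distr M N h)"

end

theory Submission
  imports Defs "HOL-Computational_Algebra.Fundamental_Theorem_Algebra"
begin

text \<open>
  A point \<open>g\<close> of the solenoid determines, for every \<open>n\<close>, its representative \<open>X\<^sub>n g\<close> in the square
  \<open>[0, R\<^sub>n)\<^sup>2\<close>, and moving \<open>g\<close> along its \<open>H\<close>-coset by \<open>z\<close> adds \<open>z\<close> to \<open>X\<^sub>n g\<close> modulo the lattice of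
  scale \<open>R\<^sub>n\<close>. The square of level \<open>n + 1\<close> is tiled by translates of the square of level \<open>n\<close>, and
  \<open>X\<^sub>n g\<close> is the position of \<open>X\<^sub>n\<^sub>+\<^sub>1 g\<close> inside its tile. So a function on \<open>G\<close> can be obtained as
  \<open>F g = lim f\<^sub>n (X\<^sub>n g)\<close> from entire functions \<open>f\<^sub>n\<close>, provided that \<open>f\<^sub>n\<^sub>+\<^sub>1\<close> is within \<open>2\<^sup>-\<^sup>n\<close> of the
  translated copy of \<open>f\<^sub>n\<close> on each tile but one, up to a margin around the tiles. On the exceptional
  tile \<open>f\<^sub>n\<^sub>+\<^sub>1\<close> imitates \<open>q\<^sub>n\<close>, where the sequence \<open>q\<close> returns infinitely often near every entire
  function. Such \<open>f\<^sub>n\<close> exist by Runge approximation (\<open>entire_glue_grid\<close>, \<open>entire_tower\<close>), since the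
  tiles without their margins are disjoint and do not separate the plane.

  Call \<open>g\<close> deep at level \<open>n\<close> if its representative keeps a distance of three tiles from the
  boundary of the square. The boundary layer has relative area \<open>O(1 / r\<^sub>n)\<close>, so by summability and
  Borel--Cantelli almost every \<open>g\<close> is deep at all large levels (\<open>AE_eventually_deep\<close>). For such
  \<open>g\<close> a whole neighbourhood of \<open>X\<^sub>n g\<close>, of size comparable to the previous square, is copied
  faithfully from each level to the next. These neighbourhoods exhaust the plane, so
  \<open>z \<mapsto> F (g + z)\<close> is a locally uniform limit of entire functions (\<open>orbit_entire\<close>). The
  neighbourhood at level \<open>n + 2\<close> contains the entire square of level \<open>n + 1\<close> around \<open>g\<close>, including
  its exceptional tile, so some translate of this limit is close to \<open>q\<^sub>n\<close> (\<open>orbit_universal\<close>).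

  Ergodicity of the image measure is inherited from ergodicity of the \<open>\<complex>\<close>-action on \<open>G\<close>
  (\<open>invariant_prob_0_or_1\<close>). Cut the square of level \<open>n\<close> into cells of side \<open>2\<^sup>-\<^sup>n\<close>. The cells of one
  level are translates of one another, so an invariant set \<open>B\<close> is independent of each of them; the
  partitions are nested and generate the Borel sets, so \<open>B\<close> is independent of itself.
\<close>

section \<open>Uniform approximation by entire functions\<close>

definition entire_approximable :: "complex set \<Rightarrow> (complex \<Rightarrow> complex) \<Rightarrow> bool" where
  "entire_approximable K f \<longleftrightarrow>
     (\<forall>e>0. \<exists>g. g holomorphic_on UNIV \<and> (\<forall>z\<in>K. norm (f z - g z) < e))"

lemma entire_approximable_entire:
  assumes "f holomorphic_on UNIV" shows "entire_approximable K f"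
  unfolding entire_approximable_def using assms by (intro allI impI exI[of _ f]) auto

lemma entire_approximable_add:
  assumes "entire_approximable K f" "entire_approximable K g"
  shows "entire_approximable K (\<lambda>z. f z + g z)"
  unfolding entire_approximable_def
proof (intro allI impI)
  fix e :: real assume e: "e > 0"
  then have "e/2 > 0" by simp
  then obtain a b where a: "a holomorphic_on UNIV" "\<And>z. z \<in> K \<Longrightarrow> norm (f z - a z) < e/2"
    and b: "b holomorphic_on UNIV" "\<And>z. z \<in> K \<Longrightarrow> norm (g z - b z) < e/2"
    using assms unfolding entire_approximable_def by metis
  show "\<exists>h. h holomorphic_on UNIV \<and> (\<forall>z\<in>K. norm (f z + g z - h z) < e)"
  proof (intro exI conjI ballI)
    show "(\<lambda>z. a z + b z) holomorphic_on UNIV" using a b by (intro holomorphic_intros)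
    fix z assume "z \<in> K"
    then show "norm (f z + g z - (a z + b z)) < e"
      using norm_diff_triangle_ineq[of "f z" "g z" "a z" "b z"] a(2)[of z] b(2)[of z] by simp
  qed
qed

lemma entire_approximable_bounded:
  assumes "compact K" "entire_approximable K f"
  obtains B where "B > 0" "\<And>z. z \<in> K \<Longrightarrow> norm (f z) \<le> B"
proof -
  obtain g where g: "g holomorphic_on UNIV" "\<And>z. z \<in> K \<Longrightarrow> norm (f z - g z) < 1"
    using assms(2) unfolding entire_approximable_def by (metis zero_less_one)
  have "compact (g ` K)"
    using g(1) assms(1) by (meson compact_continuous_image continuous_on_subset holomorphic_on_imp_continuous_on subset_UNIV)
  then obtain B where B: "\<And>z. z \<in> K \<Longrightarrow> norm (g z) \<le> B"
    by (meson compact_imp_bounded bounded_iff imageI)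
  show thesis
  proof (rule that[of "\<bar>B\<bar> + 1"])
    fix z assume z: "z \<in> K"
    have "norm (f z) \<le> norm (f z - g z) + norm (g z)"
      by (metis diff_add_cancel norm_triangle_ineq)
    then show "norm (f z) \<le> \<bar>B\<bar> + 1" using B[OF z] g(2)[OF z] by linarith
  qed auto
qed

lemma entire_approximable_mult:
  assumes K: "compact K" and f: "entire_approximable K f" and g: "entire_approximable K g"
  shows "entire_approximable K (\<lambda>z. f z * g z)"
  unfolding entire_approximable_def
proof (intro allI impI)
  fix e :: real assume e: "e > 0"
  obtain A where A: "A > 0" "\<And>z. z \<in> K \<Longrightarrow> norm (f z) \<le> A"
    using entire_approximable_bounded[OF K f] by blast
  obtain b where b: "b holomorphic_on UNIV" "\<And>z. z \<in> K \<Longrightarrow> norm (g z - b z) < e / (2 * A)"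
    using g e A(1) unfolding entire_approximable_def by (metis divide_pos_pos mult_pos_pos zero_less_numeral)
  obtain B where B: "B > 0" "\<And>z. z \<in> K \<Longrightarrow> norm (b z) \<le> B"
    using entire_approximable_bounded[OF K entire_approximable_entire[OF b(1)]] by blast
  obtain a where a: "a holomorphic_on UNIV" "\<And>z. z \<in> K \<Longrightarrow> norm (f z - a z) < e / (2 * B)"
    using f e B(1) unfolding entire_approximable_def by (metis divide_pos_pos mult_pos_pos zero_less_numeral)
  show "\<exists>h. h holomorphic_on UNIV \<and> (\<forall>z\<in>K. norm (f z * g z - h z) < e)"
  proof (intro exI conjI ballI)
    show "(\<lambda>z. a z * b z) holomorphic_on UNIV" using a b by (intro holomorphic_intros)
    fix z assume z: "z \<in> K"
    have "f z * g z - a z * b z = f z * (g z - b z) + (f z - a z) * b z" by (simp add: algebra_simps)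
    then have "norm (f z * g z - a z * b z) \<le> norm (f z) * norm (g z - b z) + norm (f z - a z) * norm (b z)"
      by (metis norm_mult norm_triangle_ineq)
    moreover have "norm (f z) * norm (g z - b z) \<le> A * norm (g z - b z)"
      using A z by (intro mult_right_mono) auto
    moreover have "A * norm (g z - b z) < e / 2"
      using b(2)[OF z] A(1) by (simp add: field_simps)
    moreover have "norm (f z - a z) * norm (b z) \<le> norm (f z - a z) * B"
      using B z by (intro mult_left_mono) auto
    moreover have "norm (f z - a z) * B < e / 2"
      using a(2)[OF z] B(1) by (simp add: field_simps)
    ultimately show "norm (f z * g z - a z * b z) < e" by linarith
  qed
qed

lemma entire_approximable_power:
  assumes "compact K" "entire_approximable K f"
  shows "entire_approximable K (\<lambda>z. f z ^ n)"
  by (induction n)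
    (use assms in \<open>simp_all add: entire_approximable_mult entire_approximable_entire\<close>)

lemma entire_approximable_sum:
  fixes f :: "nat \<Rightarrow> complex \<Rightarrow> complex"
  assumes "\<And>k. entire_approximable K (f k)"
  shows "entire_approximable K (\<lambda>z. \<Sum>k<n. f k z)"
  by (induction n)
    (use assms in \<open>simp_all add: entire_approximable_add entire_approximable_entire\<close>)

lemma entire_approximable_limit:
  assumes "\<And>e. e > 0 \<Longrightarrow> \<exists>g. entire_approximable K g \<and> (\<forall>z\<in>K. norm (f z - g z) < e)"
  shows "entire_approximable K f"
  unfolding entire_approximable_def
proof (intro allI impI)
  fix e :: real assume "e > 0"
  then have e: "e/2 > 0" by simp
  obtain g where g: "entire_approximable K g" "\<And>z. z \<in> K \<Longrightarrow> norm (f z - g z) < e/2"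
    using assms[OF e] by blast
  obtain h where h: "h holomorphic_on UNIV" "\<And>z. z \<in> K \<Longrightarrow> norm (g z - h z) < e/2"
    using g(1) e unfolding entire_approximable_def by metis
  have "norm (f z - h z) < e" if "z \<in> K" for z
    using norm_triangle_lt[of "f z - g z" "g z - h z" e] g(2)[OF that] h(2)[OF that] by simp
  with h(1) show "\<exists>h. h holomorphic_on UNIV \<and> (\<forall>z\<in>K. norm (f z - h z) < e)" by blast
qed

text \<open>Partial sums of the geometric series stay inside the algebra of approximable functions. This is
  the one step by which new functions are reached; it is used below to move poles.\<close>

lemma entire_approximable_geometric:
  fixes u v :: "complex \<Rightarrow> complex"
  assumes K: "compact K" and u: "entire_approximable K u" and v: "entire_approximable K v"
    and d: "\<And>z. z \<in> K \<Longrightarrow> norm (u z) \<le> 1/2"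
  shows "entire_approximable K (\<lambda>z. v z / (1 - u z))"
proof (rule entire_approximable_limit)
  fix e :: real assume e: "e > 0"
  obtain B where B: "B > 0" "\<And>z. z \<in> K \<Longrightarrow> norm (v z) \<le> B"
    using entire_approximable_bounded[OF K v] by blast
  obtain n where n: "(1/2::real) ^ n < e / (2 * B)"
    using real_arch_pow_inv[of "e / (2*B)" "1/2"] e B by auto
  show "\<exists>g. entire_approximable K g \<and> (\<forall>z\<in>K. norm (v z / (1 - u z) - g z) < e)"
  proof (intro exI conjI ballI)
    show "entire_approximable K (\<lambda>z. v z * (\<Sum>k<n. u z ^ k))"
      by (intro entire_approximable_mult entire_approximable_sum entire_approximable_power K u v)
    fix z assume z: "z \<in> K"
    have ne: "u z \<noteq> 1" using d[OF z] by auto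
    have half: "norm (1 - u z) \<ge> 1/2"
      using d[OF z] norm_triangle_ineq2[of 1 "u z"] by simp
    have "v z / (1 - u z) - v z * (\<Sum>k<n. u z ^ k) = v z * u z ^ n / (1 - u z)"
      using ne by (simp add: sum_gp_strict divide_simps) (simp add: algebra_simps)
    also have "norm \<dots> = norm (v z) * norm (u z) ^ n / norm (1 - u z)"
      by (simp add: norm_divide norm_mult norm_power)
    also have "\<dots> \<le> B * (1/2) ^ n / (1/2)"
      using B d[OF z] z half by (intro frac_le mult_mono power_mono) auto
    also have "\<dots> < e" using n B by (simp add: field_simps)
    finally show "norm (v z / (1 - u z) - v z * (\<Sum>k<n. u z ^ k)) < e" .
  qed
qed

text \<open>Pole pushing along the imaginary axis, which avoids \<open>K\<close> by the margin \<open>d\<close>. A pole far from \<open>K\<close>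
  is harmless, as \<open>1 / (z - b)\<close> is then a geometric series in \<open>z / b\<close>. A pole at \<open>a\<close> may be moved to
  \<open>b\<close> with \<open>|b - a| = d/2\<close> by expanding \<open>1 / (z - b)\<close> in powers of \<open>(b - a) / (z - a)\<close>. So any pole on
  the axis is reached from infinity in finitely many steps of length \<open>d/2\<close>.\<close>

lemma entire_approximable_pole:
  assumes K: "compact K" and d: "d > 0" and dist: "\<And>z. z \<in> K \<Longrightarrow> d \<le> \<bar>Re z\<bar>"
    and b: "Re b = 0"
  shows "entire_approximable K (\<lambda>z. 1 / (z - b))"
proof -
  obtain L where L: "L > 0" "\<And>z. z \<in> K \<Longrightarrow> norm z \<le> L"
    using compact_imp_bounded[OF K] unfolding bounded_pos by blast
  have id: "entire_approximable K (\<lambda>z. z)" by (intro entire_approximable_entire holomorphic_intros)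
  have const: "entire_approximable K (\<lambda>z. c)" for c by (intro entire_approximable_entire holomorphic_intros)
  have "2 * L \<le> norm (b + of_nat n * (d/2) * \<i>) \<Longrightarrow> Re b = 0 \<Longrightarrow> ?thesis" for n
  proof (induction n arbitrary: b)
    case 0
    then have bn: "norm b \<ge> 2 * L" by simp
    then have b0: "b \<noteq> 0" using L by auto
    have "entire_approximable K (\<lambda>z. (-1/b) / (1 - z * (1/b)))"
    proof (rule entire_approximable_geometric[OF K])
      show "entire_approximable K (\<lambda>z. z * (1/b))" by (intro entire_approximable_mult K id const)
      show "entire_approximable K (\<lambda>z. -1/b)" by (rule const)
      fix z assume "z \<in> K"
      then have "norm z \<le> norm b / 2" using L bn by fastforce
      then show "norm (z * (1/b)) \<le> 1/2" using b0 by (simp add: norm_mult norm_divide field_simps)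
    qed
    moreover have "(\<lambda>z. (-1/b) / (1 - z * (1/b))) = (\<lambda>z. 1 / (z - b))"
    proof
      fix z show "(-1/b) / (1 - z * (1/b)) = 1 / (z - b)"
        using b0 by (cases "z = b") (auto simp: divide_simps)
    qed
    ultimately show ?case by simp
  next
    case (Suc n)
    define a where "a = b + of_real (d/2) * \<i>"
    have a: "entire_approximable K (\<lambda>z. 1 / (z - a))"
      using Suc.prems by (intro Suc.IH) (auto simp: a_def algebra_simps add_divide_distrib)
    have "entire_approximable K (\<lambda>z. 1 / (z - a) / (1 - (b - a) * (1 / (z - a))))"
    proof (rule entire_approximable_geometric[OF K _ a])
      show "entire_approximable K (\<lambda>z. (b - a) * (1 / (z - a)))"
        by (intro entire_approximable_mult K const a)
      fix z assume z: "z \<in> K"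
      have "d \<le> \<bar>Re (z - a)\<bar>" using dist[OF z] Suc.prems by (simp add: a_def)
      also have "\<dots> \<le> norm (z - a)" by (rule abs_Re_le_cmod)
      finally have "d \<le> norm (z - a)" .
      moreover have "norm (b - a) = d/2" using d by (simp add: a_def norm_mult)
      ultimately show "norm ((b - a) * (1 / (z - a))) \<le> 1/2"
        using d by (simp add: norm_mult norm_divide divide_le_eq)
    qed
    then have "entire_approximable K (\<lambda>z. if z \<in> K then 1 / (z - b) else 1 / (z - a) / (1 - (b - a) * (1 / (z - a))))"
    proof (rule back_subst[where P="entire_approximable K"], intro ext)
      fix z
      show "1 / (z - a) / (1 - (b - a) * (1 / (z - a))) = (if z \<in> K then 1 / (z - b) else 1 / (z - a) / (1 - (b - a) * (1 / (z - a))))"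
      proof (cases "z \<in> K")
        case True
        have "z \<noteq> a" "z \<noteq> b" using dist[OF True] Suc.prems d by (auto simp: a_def)
        then show ?thesis using True by (simp add: divide_simps)
      qed simp
    qed
    then show ?case unfolding entire_approximable_def by simp
  qed
  moreover obtain n where "2 * L + norm b < of_nat n * (d/2)"
    using reals_Archimedean3[of "d/2"] d by (metis half_gt_zero)
  moreover have "of_nat n * (d/2) - norm b \<le> norm (b + of_nat n * (d/2) * \<i>)" for n
    using norm_triangle_ineq2[of "of_nat n * (d/2) * \<i>" "-b"] d by (simp add: norm_mult add.commute)
  ultimately show ?thesis using b by (smt (verit))
qed

text \<open>Splitting off one linear factor at a time reduces this to a single pole on the axis.\<close>

lemma entire_approximable_inverse_poly:
  assumes K: "compact K" and d: "d > 0" and dist: "\<And>z. z \<in> K \<Longrightarrow> d \<le> \<bar>Re z\<bar>"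
  shows "p \<noteq> 0 \<Longrightarrow> (\<And>z. poly p z = 0 \<Longrightarrow> Re z = 0) \<Longrightarrow>
    entire_approximable K (\<lambda>z. 1 / poly p z)"
proof (induction "degree p" arbitrary: p)
  case 0
  then obtain c where "p = [:c:]" by (metis degree_eq_zeroE)
  then show ?case by (simp add: entire_approximable_entire)
next
  case (Suc n)
  then obtain a where a: "poly p a = 0"
    using alg_closed_imp_poly_has_root[of p] by auto
  then obtain q where q: "p = [:-a, 1:] * q" by (metis dvdE poly_eq_0_iff_dvd)
  have q0: "q \<noteq> 0" using Suc.prems q by auto
  have "degree p = Suc (degree q)" unfolding q using q0 by (subst degree_mult_eq) auto
  then have "entire_approximable K (\<lambda>z. 1 / poly q z)"
    using Suc.hyps(2) q0 Suc.prems(2) q by (intro Suc.hyps(1)) auto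
  then have "entire_approximable K (\<lambda>z. 1 / (z - a) * (1 / poly q z))"
    using Suc.prems(2)[OF a] by (intro entire_approximable_mult entire_approximable_pole[OF K d dist] K)
  then show ?case by (simp add: q algebra_simps)
qed

section \<open>Separating half-planes and gluing along a grid\<close>

text \<open>The Moebius map \<open>(z - 1) / (z + 1)\<close> takes the right half-plane to the unit disc; on the part with
  \<open>|z| \<le> L\<close> and \<open>Re z \<ge> d\<close> it stays away from the unit circle by an explicit factor.\<close>

lemma half_plane_ratio:
  assumes z: "norm z \<le> L" "d \<le> Re z" and d: "d > 0"
  shows "norm (z - 1) ^ 2 \<le> (L\<^sup>2 + 1 - 2*d) / (L\<^sup>2 + 1 + 2*d) * norm (z + 1) ^ 2"
proof -
  have n: "norm z ^ 2 \<le> L\<^sup>2" using z by (simp add: power_mono)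
  have 1: "norm (z - 1) ^ 2 = norm z ^ 2 + 1 - 2 * Re z" "norm (z + 1) ^ 2 = norm z ^ 2 + 1 + 2 * Re z"
    by (simp_all only: cmod_power2) (simp_all add: power2_eq_square algebra_simps)
  have "(norm z ^ 2 + 1) * d \<le> (L\<^sup>2 + 1) * Re z"
    using n z d by (intro mult_mono) auto
  then have "(norm z ^ 2 + 1 - 2 * Re z) * (L\<^sup>2 + 1 + 2*d) \<le> (L\<^sup>2 + 1 - 2*d) * (norm z ^ 2 + 1 + 2 * Re z)"
    by (simp add: algebra_simps)
  moreover have "0 < L\<^sup>2 + 1 + 2*d" using d by (smt (verit) zero_le_power2)
  ultimately show ?thesis unfolding 1 by (simp add: pos_le_divide_eq)
qed

lemma ratio_close_one:
  fixes p q :: complex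
  assumes "norm q \<le> t * norm p" "t < 1" "p \<noteq> 0"
  shows "p + q \<noteq> 0" "norm (q / (p + q)) \<le> t / (1 - t)"
proof -
  have p: "norm p > 0" using assms by simp
  have 1: "norm (p + q) \<ge> (1 - t) * norm p"
    using norm_triangle_ineq2[of p "-q"] assms(1) by (simp add: algebra_simps)
  have 2: "(1 - t) * norm p > 0" using assms p by simp
  show "p + q \<noteq> 0" using 1 2 by force
  have "norm q / norm (p + q) \<le> t * norm p / ((1 - t) * norm p)"
    using assms 1 2 p by (intro frac_le) (auto intro: order_trans[OF norm_ge_zero])
  then show "norm (q / (p + q)) \<le> t / (1 - t)" using p by (simp add: norm_divide)
qed

text \<open>For large \<open>m\<close> the rational function \<open>(z + 1)\<^sup>2\<^sup>m / ((z + 1)\<^sup>2\<^sup>m + (z - 1)\<^sup>2\<^sup>m)\<close> is nearly 1 on the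
  right and nearly 0 on the left. Its poles satisfy \<open>|z + 1| = |z - 1|\<close>, so they lie on the
  imaginary axis and the function is approximable by entire ones. This replaces Runge's theorem.\<close>

lemma entire_separator:
  fixes L d e :: real
  assumes d: "d > 0" and e: "e > 0"
  obtains s where "s holomorphic_on UNIV"
    "\<And>z. norm z \<le> L \<Longrightarrow> d \<le> Re z \<Longrightarrow> norm (s z - 1) < e"
    "\<And>z. norm z \<le> L \<Longrightarrow> Re z \<le> -d \<Longrightarrow> norm (s z) < e"
proof -
  define K where "K = {z. norm z \<le> L \<and> d \<le> \<bar>Re z\<bar>}"
  have "K = cball 0 L \<inter> {z. d \<le> \<bar>Re z\<bar>}" by (auto simp: K_def)
  moreover have "closed {z. d \<le> \<bar>Re z\<bar>}" by (intro closed_Collect_le continuous_intros)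
  ultimately have K: "compact K" by (simp add: compact_Int_closed)
  have dist: "d \<le> \<bar>Re z\<bar>" if "z \<in> K" for z using that by (simp add: K_def)
  \<comment> \<open>The absolute value keeps \<open>t\<close> nonnegative when no point satisfies both constraints on \<open>z\<close>.\<close>
  define t where "t = \<bar>L\<^sup>2 + 1 - 2*d\<bar> / (L\<^sup>2 + 1 + 2*d)"
  have tpos: "L\<^sup>2 + 1 + 2*d > 0" using d by (smt (verit) zero_le_power2)
  have "\<bar>L\<^sup>2 + 1 - 2*d\<bar> < L\<^sup>2 + 1 + 2*d" using d by (smt (verit) zero_le_power2)
  then have t: "0 \<le> t" "t < 1" using tpos by (auto simp: t_def)
  have "((\<lambda>m. t ^ m / (1 - t ^ m)) \<longlongrightarrow> 0 / (1 - 0)) sequentially"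
    using t by (intro tendsto_intros LIMSEQ_realpow_zero) auto
  then have "\<forall>\<^sub>F m in sequentially. t ^ m / (1 - t ^ m) < e/2"
    using e by (intro order_tendstoD(2)[where y=0]) simp_all
  then obtain m where m: "t ^ m / (1 - t ^ m) < e/2" "m \<ge> 1"
    unfolding eventually_sequentially by (metis linear le_trans)
  have tm: "t ^ m < 1" using t m(2) by (simp add: power_less_one_iff)
  define p where "p = [:1, 1::complex:] ^ (2*m)"
  define q where "q = [:-1, 1::complex:] ^ (2*m)"
  have [simp]: "poly p z = (z + 1) ^ (2*m)" "poly q z = (z - 1) ^ (2*m)" for z
    by (simp_all add: p_def q_def add.commute)
  have ratio: "norm ((z - 1) ^ (2*m)) \<le> t ^ m * norm ((z + 1) ^ (2*m))"
    if z: "norm z \<le> L'" "d' \<le> Re z" "d' > 0" "\<bar>L'^2 + 1 - 2*d'\<bar> / (L'^2 + 1 + 2*d') \<le> t" for z L' d'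
  proof -
    have "(L'\<^sup>2 + 1 - 2 * d') / (L'\<^sup>2 + 1 + 2 * d') \<le> \<bar>L'^2 + 1 - 2*d'\<bar> / (L'^2 + 1 + 2*d')"
      using z by (intro divide_right_mono) (auto simp: add_nonneg_nonneg)
    then have "(L'\<^sup>2 + 1 - 2 * d') / (L'\<^sup>2 + 1 + 2 * d') \<le> t" using z(4) by linarith
    then have "norm (z - 1) ^ 2 \<le> t * norm (z + 1) ^ 2"
      using half_plane_ratio[OF z(1,2,3)] by (smt (verit, best) mult_right_mono zero_le_power2)
    then have "(norm (z - 1) ^ 2) ^ m \<le> (t * norm (z + 1) ^ 2) ^ m"
      by (intro power_mono) auto
    then show ?thesis by (simp add: norm_power power_mult_distrib power_mult)
  qed
  have right: "norm ((z - 1) ^ (2*m)) \<le> t ^ m * norm ((z + 1) ^ (2*m))" if "norm z \<le> L" "d \<le> Re z" for z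
    by (rule ratio[of z L d]) (use that d in \<open>auto simp: t_def\<close>)
  have left: "norm ((z + 1) ^ (2*m)) \<le> t ^ m * norm ((z - 1) ^ (2*m))" if "norm z \<le> L" "Re z \<le> -d" for z
  proof -
    have "(- z - 1) ^ (2*m) = (z + 1) ^ (2*m)" "(- z + 1) ^ (2*m) = (z - 1) ^ (2*m)"
      by (simp_all add: power_mult power2_commute flip: power2_minus[of "z + 1"])
    then show ?thesis using right[of "-z"] that by simp
  qed
  have "entire_approximable K (\<lambda>z. 1 / poly (p + q) z)"
  proof (rule entire_approximable_inverse_poly[OF K d dist])
    have "poly (p + q) 1 \<noteq> 0" using m(2) by (simp add: power_0_left)
    then show "p + q \<noteq> 0" by force
    fix z assume "poly (p + q) z = 0"
    then have "(z + 1) ^ (2*m) = - ((z - 1) ^ (2*m))" by (simp add: add_eq_0_iff2)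
    then have "norm (z + 1) ^ (2*m) = norm (z - 1) ^ (2*m)" by (metis norm_minus_cancel norm_power)
    then have "norm (z + 1) = norm (z - 1)" using m(2) by (subst (asm) power_eq_iff_eq_base) auto
    then have "norm (z + 1) ^ 2 = norm (z - 1) ^ 2" by simp
    then show "Re z = 0" unfolding cmod_power2 by (simp add: power2_eq_square algebra_simps)
  qed
  then have "entire_approximable K (\<lambda>z. (z + 1) ^ (2*m) * (1 / poly (p + q) z))"
    by (intro entire_approximable_mult K) (auto intro!: entire_approximable_entire holomorphic_intros)
  then have *: "entire_approximable K (\<lambda>z. (z + 1) ^ (2*m) / ((z + 1) ^ (2*m) + (z - 1) ^ (2*m)))"
    by simp
  have e2: "e/2 > 0" using e by simp
  obtain s where s: "s holomorphic_on UNIV"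
    "\<And>z. z \<in> K \<Longrightarrow> norm ((z + 1) ^ (2*m) / ((z + 1) ^ (2*m) + (z - 1) ^ (2*m)) - s z) < e/2"
    using *[unfolded entire_approximable_def, rule_format, OF e2] by blast
  show thesis
  proof (rule that[OF s(1)])
    fix z assume z: "norm z \<le> L" "d \<le> Re z"
    then have zK: "z \<in> K" by (simp add: K_def)
    have "z + 1 \<noteq> 0" using z d by (auto simp: complex_eq_iff)
    then have ne: "(z + 1) ^ (2*m) \<noteq> 0" by simp
    note r = ratio_close_one[OF right[OF z] tm ne]
    have "(z + 1) ^ (2*m) / ((z + 1) ^ (2*m) + (z - 1) ^ (2*m)) - 1 = - ((z - 1) ^ (2*m) / ((z + 1) ^ (2*m) + (z - 1) ^ (2*m)))"
      using r(1) by (simp add: field_simps)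
    then have "norm ((z + 1) ^ (2*m) / ((z + 1) ^ (2*m) + (z - 1) ^ (2*m)) - 1) < e/2"
      by (metis norm_minus_cancel order_le_less_trans r(2) m(1))
    then show "norm (s z - 1) < e"
      using s(2)[OF zK] by (metis dist_norm dist_commute dist_triangle_half_l)
  next
    fix z assume z: "norm z \<le> L" "Re z \<le> -d"
    then have zK: "z \<in> K" using d by (simp add: K_def)
    have "z - 1 \<noteq> 0" using z d by (auto simp: complex_eq_iff)
    then have ne: "(z - 1) ^ (2*m) \<noteq> 0" by simp
    note r = ratio_close_one[OF left[OF z] tm ne]
    have "norm ((z + 1) ^ (2*m) / ((z + 1) ^ (2*m) + (z - 1) ^ (2*m))) < e/2"
      using r(2) m(1) unfolding add.commute[of "(z + 1) ^ (2*m)"] by linarith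
    then show "norm (s z) < e"
      using s(2)[OF zK] norm_triangle_ineq2[of "s z" "(z + 1) ^ (2*m) / ((z + 1) ^ (2*m) + (z - 1) ^ (2*m))"]
      by (simp add: norm_minus_commute)
  qed
qed

text \<open>Interpolate between \<open>h1\<close> and \<open>h2\<close> by a separator \<open>s\<close>, as \<open>h1 + s (h2 - h1)\<close>; on the disc of radius
  \<open>L\<close> the bounded factor \<open>h2 - h1\<close> only rescales the error. The unit vector \<open>u\<close> turns the dividing line,
  so that the same statement serves for vertical and for horizontal lines.\<close>

lemma entire_glue:
  fixes L d e t :: real and u :: complex
  assumes h: "h1 holomorphic_on UNIV" "h2 holomorphic_on UNIV" and u: "norm u = 1"
    and d: "d > 0" and e: "e > 0"
  obtains f where "f holomorphic_on UNIV"
    "\<And>z. norm z \<le> L \<Longrightarrow> Re (u * z) \<le> t - d \<Longrightarrow> norm (f z - h1 z) < e"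
    "\<And>z. norm z \<le> L \<Longrightarrow> t + d \<le> Re (u * z) \<Longrightarrow> norm (f z - h2 z) < e"
proof -
  have "entire_approximable (cball 0 L) (\<lambda>z. h2 z - h1 z)"
    using h by (intro entire_approximable_entire holomorphic_intros)
  then obtain B where B: "B > 0" "\<And>z. norm z \<le> L \<Longrightarrow> norm (h2 z - h1 z) \<le> B"
    using entire_approximable_bounded[OF compact_cball, of 0 L "\<lambda>z. h2 z - h1 z"]
    by (metis mem_cball_0)
  obtain s where s: "s holomorphic_on UNIV"
    "\<And>z. norm z \<le> L + \<bar>t\<bar> \<Longrightarrow> d \<le> Re z \<Longrightarrow> norm (s z - 1) < e / B"
    "\<And>z. norm z \<le> L + \<bar>t\<bar> \<Longrightarrow> Re z \<le> -d \<Longrightarrow> norm (s z) < e / B"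
    using entire_separator[of d "e / B" "L + \<bar>t\<bar>"] d e B(1) by (metis divide_pos_pos)
  define f where "f z = h1 z + s (u * z - t) * (h2 z - h1 z)" for z
  have nm: "norm (u * z - t) \<le> L + \<bar>t\<bar>" if "norm z \<le> L" for z
    using norm_triangle_ineq4[of "u * z" "of_real t"] that u by (simp add: norm_mult)
  have key: "norm (w * (h2 z - h1 z)) < e" if "norm z \<le> L" "norm w < e / B" for w z
  proof -
    have "norm w * norm (h2 z - h1 z) \<le> norm w * B" using B(2)[OF that(1)] by (intro mult_left_mono) auto
    also have "\<dots> < e" using that(2) B(1) by (simp add: field_simps)
    finally show ?thesis by (simp add: norm_mult)
  qed
  show thesis
  proof (rule that[of f])
    have "(s \<circ> (\<lambda>z. u * z - t)) holomorphic_on UNIV"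
      by (rule holomorphic_on_compose_gen[OF _ s(1)]) (auto intro!: holomorphic_intros)
    then show "f holomorphic_on UNIV"
      unfolding f_def o_def using h by (intro holomorphic_intros) auto
  next
    fix z assume z: "norm z \<le> L" "Re (u * z) \<le> t - d"
    have "norm (s (u * z - t) * (h2 z - h1 z)) < e"
      using s(3)[OF nm[OF z(1)]] z by (intro key) auto
    then show "norm (f z - h1 z) < e" by (simp add: f_def)
  next
    fix z assume z: "norm z \<le> L" "t + d \<le> Re (u * z)"
    have "norm ((s (u * z - t) - 1) * (h2 z - h1 z)) < e"
      using s(2)[OF nm[OF z(1)]] z by (intro key) auto
    moreover have "f z - h2 z = (s (u * z - t) - 1) * (h2 z - h1 z)" by (simp add: f_def algebra_simps)
    ultimately show "norm (f z - h2 z) < e" by simp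
  qed
qed

lemma entire_glue_strips:
  fixes L d R :: real and u :: complex and h :: "nat \<Rightarrow> complex \<Rightarrow> complex"
  assumes h: "\<And>a. h a holomorphic_on UNIV" and u: "norm u = 1" and d: "d > 0" and R: "R > 0"
  shows "e > 0 \<Longrightarrow> \<exists>f. f holomorphic_on UNIV \<and> (\<forall>a<m. \<forall>z. norm z \<le> L \<longrightarrow> a * R + d \<le> Re (u * z) \<longrightarrow>
     Re (u * z) \<le> (a + 1) * R - d \<longrightarrow> norm (f z - h a z) < e)"
proof (induction m arbitrary: e)
  case 0
  then show ?case by (intro exI[of _ "\<lambda>_. 0"]) auto
next
  case (Suc m)
  then have e2: "e/2 > 0" by simp
  obtain f where f: "f holomorphic_on UNIV"
    "\<And>a z. a < m \<Longrightarrow> norm z \<le> L \<Longrightarrow> a * R + d \<le> Re (u * z) \<Longrightarrow> Re (u * z) \<le> (a + 1) * R - d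
       \<Longrightarrow> norm (f z - h a z) < e/2"
    using Suc.IH[OF e2] by blast
  obtain g where g: "g holomorphic_on UNIV"
    "\<And>z. norm z \<le> L \<Longrightarrow> Re (u * z) \<le> real m * R - d \<Longrightarrow> norm (g z - f z) < e/2"
    "\<And>z. norm z \<le> L \<Longrightarrow> real m * R + d \<le> Re (u * z) \<Longrightarrow> norm (g z - h m z) < e/2"
    using entire_glue[OF f(1) h u d e2, of L "real m * R"] by blast
  have "norm (g z - h a z) < e"
    if a: "a < Suc m" and z: "norm z \<le> L" "a * R + d \<le> Re (u * z)" "Re (u * z) \<le> (a + 1) * R - d" for a z
  proof (cases "a = m")
    case True
    then show ?thesis using g(3)[of z] z e2 by auto
  next
    case False
    then have am: "a < m" using a by simp
    have "(real a + 1) * R \<le> real m * R" using am R by (intro mult_right_mono) auto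
    then have "norm (g z - f z) < e/2" using z by (intro g(2)) auto
    moreover have "norm (f z - h a z) < e/2" using f(2)[OF am] z by simp
    ultimately show ?thesis by (metis dist_norm dist_commute dist_triangle_half_l)
  qed
  with g(1) show ?case by blast
qed

text \<open>Glue along the vertical lines within each row, then glue the rows along the horizontal lines.\<close>

lemma entire_glue_grid:
  fixes L d R :: real and h :: "nat \<Rightarrow> nat \<Rightarrow> complex \<Rightarrow> complex"
  assumes h: "\<And>a b. h a b holomorphic_on UNIV" and d: "d > 0" and R: "R > 0" and e: "e > 0"
  obtains f where "f holomorphic_on UNIV"
    "\<And>a b z. a < m \<Longrightarrow> b < m \<Longrightarrow> norm z \<le> L \<Longrightarrow>
       a * R + d \<le> Re z \<Longrightarrow> Re z \<le> (a + 1) * R - d \<Longrightarrow>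
       b * R + d \<le> Im z \<Longrightarrow> Im z \<le> (b + 1) * R - d \<Longrightarrow> norm (f z - h a b z) < e"
proof -
  have e2: "e/2 > 0" using e by simp
  have "\<exists>g. g holomorphic_on UNIV \<and> (\<forall>a<m. \<forall>z. norm z \<le> L \<longrightarrow> a * R + d \<le> Re (1 * z) \<longrightarrow>
     Re (1 * z) \<le> (a + 1) * R - d \<longrightarrow> norm (g z - h a b z) < e/2)" for b
    by (rule entire_glue_strips) (use h d R e2 in auto)
  then obtain g where g: "\<And>b. g b holomorphic_on UNIV"
    "\<And>a b z. a < m \<Longrightarrow> norm z \<le> L \<Longrightarrow> a * R + d \<le> Re z \<Longrightarrow> Re z \<le> (a + 1) * R - d
       \<Longrightarrow> norm (g b z - h a b z) < e/2"
    by (simp only: mult_1) metis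
  have "\<exists>f. f holomorphic_on UNIV \<and> (\<forall>b<m. \<forall>z. norm z \<le> L \<longrightarrow> b * R + d \<le> Re (- \<i> * z) \<longrightarrow>
     Re (- \<i> * z) \<le> (b + 1) * R - d \<longrightarrow> norm (f z - g b z) < e/2)"
    by (rule entire_glue_strips) (use g d R e2 in auto)
  then obtain f where f: "f holomorphic_on UNIV"
    "\<And>b z. b < m \<Longrightarrow> norm z \<le> L \<Longrightarrow> b * R + d \<le> Im z \<Longrightarrow> Im z \<le> (b + 1) * R - d
       \<Longrightarrow> norm (f z - g b z) < e/2"
    by auto
  show thesis
    by (rule that[OF f(1)]) (metis f(2) g(2) dist_norm dist_commute dist_triangle_half_l)
qed

section \<open>A tower of entire functions\<close>

text \<open>The square of side \<open>R (Suc n)\<close> without a margin of width \<open>R n\<close>. The translates of the core by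
  multiples of \<open>R (Suc n)\<close> are separated by corridors, in which gluing may take place.\<close>

definition core :: "(nat \<Rightarrow> nat) \<Rightarrow> nat \<Rightarrow> complex set" where
  "core R n = {z. real (R n) \<le> Re z \<and> Re z \<le> real (R (Suc n)) - real (R n) \<and>
                  real (R n) \<le> Im z \<and> Im z \<le> real (R (Suc n)) - real (R n)}"

text \<open>\<open>g\<close> copies \<open>f\<close> on all tiles of the next larger square except the tile \<open>(1, 1)\<close>, where it copies \<open>q\<close>,
  with the origin moved to a point that is \<open>2 R n\<close> away from two sides of the tile. The exceptional tile is the one
  with indices \<open>(1, 1)\<close> and not a corner tile: it has to lie in the core of the larger square, so that
  higher levels reproduce it, and still within three tiles of the boundary, so that the base point
  of a typical orbit avoids it.\<close>

definition tiles :: "(nat \<Rightarrow> nat) \<Rightarrow> nat \<Rightarrow> (complex \<Rightarrow> complex) \<Rightarrow> (complex \<Rightarrow> complex) \<Rightarrow>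
    (complex \<Rightarrow> complex) \<Rightarrow> bool" where
  "tiles R n q f g \<longleftrightarrow> (\<forall>a b z. a < R (Suc (Suc n)) div R (Suc n) \<longrightarrow>
     b < R (Suc (Suc n)) div R (Suc n) \<longrightarrow> z \<in> core R n \<longrightarrow>
     norm (g (z + of_nat (R (Suc n)) * Complex (of_nat a) (of_nat b)) -
       (if a = 1 \<and> b = 1 then q (z - of_nat (R n) * Complex 2 2) else f z)) < (1/2) ^ n)"

text \<open>The corridors between the cores have width \<open>2 R n\<close>, so grid gluing with \<open>d = R n\<close> applies.\<close>

lemma exists_tiling:
  assumes R: "R n > 0" "R (Suc n) > 0" and dvd: "R (Suc n) dvd R (Suc (Suc n))"
    and f: "f holomorphic_on UNIV" and q: "q holomorphic_on UNIV"
  shows "\<exists>g. g holomorphic_on UNIV \<and> tiles R n q f g"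
proof -
  define e :: real where "e = (1/2) ^ n"
  have e: "e > 0" by (simp add: e_def)
  define k where "k = R (Suc (Suc n)) div R (Suc n)"
  have k: "R (Suc (Suc n)) = k * R (Suc n)" using dvd by (simp add: k_def)
  define h where "h a b = (\<lambda>z. if a = 1 \<and> b = 1 then q (z - of_nat (R (Suc n)) * Complex 1 1 - of_nat (R n) * Complex 2 2)
     else f (z - of_nat (R (Suc n)) * Complex (of_nat a) (of_nat b)))" for a b :: nat
  have comp: "(\<lambda>z. p (z - c)) holomorphic_on UNIV" if "p holomorphic_on UNIV" for p :: "complex \<Rightarrow> complex" and c
  proof -
    have "(\<lambda>z. z - c) holomorphic_on UNIV" by (intro holomorphic_intros)
    from holomorphic_on_compose_gen[OF this that] show ?thesis by (simp add: o_def)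
  qed
  have "h a b holomorphic_on UNIV" for a b
    using comp[OF f] comp[OF q, of "of_nat (R (Suc n)) * Complex 1 1 + of_nat (R n) * Complex 2 2"]
    unfolding h_def diff_diff_eq by (cases "a = 1 \<and> b = 1") (simp_all only: if_True if_False simp_thms)
  then obtain g where g: "g holomorphic_on UNIV"
    "\<And>a b z. a < k \<Longrightarrow> b < k \<Longrightarrow> norm z \<le> 2 * real (R (Suc (Suc n))) \<Longrightarrow>
       a * real (R (Suc n)) + real (R n) \<le> Re z \<Longrightarrow> Re z \<le> (a + 1) * real (R (Suc n)) - real (R n) \<Longrightarrow>
       b * real (R (Suc n)) + real (R n) \<le> Im z \<Longrightarrow> Im z \<le> (b + 1) * real (R (Suc n)) - real (R n) \<Longrightarrow> norm (g z - h a b z) < e"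
    using entire_glue_grid[of h "real (R n)" "real (R (Suc n))" e k "2 * real (R (Suc (Suc n)))"] R e
    by (metis of_nat_0_less_iff)
  have "norm (g (z + of_nat (R (Suc n)) * Complex (of_nat a) (of_nat b)) -
        (if a = 1 \<and> b = 1 then q (z - of_nat (R n) * Complex 2 2) else f z)) < e"
    if a: "a < k" and b: "b < k" and z: "z \<in> core R n" for a b z
  proof -
    define w where "w = z + of_nat (R (Suc n)) * Complex (of_nat a) (of_nat b)"
    have w: "Re w = Re z + a * real (R (Suc n))" "Im w = Im z + b * real (R (Suc n))"
      by (simp_all add: w_def)
    have bounds: "a * real (R (Suc n)) + real (R n) \<le> Re w" "Re w \<le> (real a + 1) * real (R (Suc n)) - real (R n)"
       "b * real (R (Suc n)) + real (R n) \<le> Im w" "Im w \<le> (real b + 1) * real (R (Suc n)) - real (R n)"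
      using z unfolding w core_def by (auto simp: algebra_simps)
    have "(real a + 1) * real (R (Suc n)) \<le> real k * real (R (Suc n))" "(real b + 1) * real (R (Suc n)) \<le> real k * real (R (Suc n))"
      using a b by (intro mult_right_mono; simp)+
    moreover have "0 \<le> real a * real (R (Suc n))" "0 \<le> real b * real (R (Suc n))" by simp_all
    ultimately have "\<bar>Re w\<bar> \<le> real (R (Suc (Suc n)))" "\<bar>Im w\<bar> \<le> real (R (Suc (Suc n)))"
      using bounds unfolding k of_nat_mult by (smt (verit) of_nat_0_le_iff)+
    then have "norm w \<le> 2 * real (R (Suc (Suc n)))" using cmod_le[of w] by linarith
    then have "norm (g w - h a b w) < e" using g(2)[OF a b _ bounds] by simp
    moreover have "h a b w = (if a = 1 \<and> b = 1 then q (z - of_nat (R n) * Complex 2 2) else f z)"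
      by (auto simp: h_def w_def)
    ultimately show ?thesis by (simp add: w_def)
  qed
  with g(1) show ?thesis unfolding k_def e_def tiles_def by blast
qed

lemma entire_tower:
  assumes R: "\<And>n. R n > 0" and dvd: "\<And>n. R n dvd R (Suc n)"
    and q: "\<And>n. q n holomorphic_on UNIV"
  obtains f :: "nat \<Rightarrow> complex \<Rightarrow> complex"
    where "\<And>n. f n holomorphic_on UNIV" "\<And>n. tiles R n (q n) (f n) (f (Suc n))"
proof -
  have "\<exists>f. \<forall>n. f n holomorphic_on UNIV \<and> tiles R n (q n) (f n) (f (Suc n))"
  proof (rule dependent_nat_choice)
    show "\<exists>f::complex \<Rightarrow> complex. f holomorphic_on UNIV" by (rule exI[of _ "\<lambda>_. 0"]) simp
  qed (intro exists_tiling R dvd q, auto)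
  then show thesis using that by blast
qed

text \<open>Polynomials with coefficients in a countable dense set, obtained by truncating a Taylor series and
  perturbing its coefficients. Each of them is listed infinitely often, which gives arbitrarily late
  approximants.\<close>

lemma entire_dense_sequence:
  obtains q :: "nat \<Rightarrow> complex \<Rightarrow> complex" where "\<And>n. q n holomorphic_on UNIV"
    "\<And>p k e m. p holomorphic_on UNIV \<Longrightarrow> (e::real) > 0 \<Longrightarrow> \<exists>n\<ge>m. \<forall>z. norm z \<le> k \<longrightarrow> norm (q n z - p z) < e"
proof -
  obtain D :: "complex set" where D: "countable D" "\<And>X. open X \<Longrightarrow> X \<noteq> {} \<Longrightarrow> \<exists>d\<in>D. d \<in> X"
    using countable_dense_exists by blast
  have "D \<noteq> {}" using D(2)[of UNIV] by auto
  define P where "P l = (\<lambda>z. \<Sum>j<length l. (l ! j) * z ^ j)" for l :: "complex list"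
  have ne: "lists D \<noteq> {}" by auto
  have cl: "countable (lists D)" using D(1) by (rule countable_lists)
  \<comment> \<open>Only the first component of the decoded pair is used, which repeats every polynomial infinitely often.\<close>
  define q where "q n = P (from_nat_into (lists D) (fst (prod_decode n)))" for n
  show thesis
  proof (rule that[of q])
    show "q n holomorphic_on UNIV" for n
      unfolding q_def P_def by (intro holomorphic_intros)
  next
    fix p :: "complex \<Rightarrow> complex" and k e :: real and m :: nat
    assume p: "p holomorphic_on UNIV" and e: "e > 0"
    \<comment> \<open>A radius of at least 1 makes the powers of \<open>K\<close> increasing.\<close>
    define K where "K = \<bar>k\<bar> + 1"
    have K: "K > 0" by (simp add: K_def)
    define c where "c j = (deriv ^^ j) p 0 / fact j" for j
    have sums: "(\<lambda>j. c j * z ^ j) sums p z" for z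
      using holomorphic_power_series[of p 0 "norm z + 1" z] p holomorphic_on_subset
      unfolding c_def by auto
    have "summable (\<lambda>j. norm (c j * of_real K ^ j))"
    proof (rule powser_insidea)
      show "summable (\<lambda>j. c j * of_real (K + 1) ^ j)" using sums sums_summable by blast
    qed (use K in simp)
    then have smK: "summable (\<lambda>j. norm (c j) * K ^ j)"
      using K by (simp add: norm_mult norm_power)
    have "\<forall>\<^sub>F n in sequentially. norm (\<Sum>j. norm (c (j + n)) * K ^ (j + n)) < e/2"
      using order_tendstoD(2)[OF tendsto_norm[OF suminf_exist_split2[OF smK]], of "e/2"] e by simp
    then obtain n where n: "norm (\<Sum>j. norm (c (j + n)) * K ^ (j + n)) < e/2"
      by (auto simp: eventually_sequentially)
    have tail: "norm (p z - (\<Sum>j<n. c j * z ^ j)) < e/2" if z: "norm z \<le> k" for z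
    proof -
      have zK: "norm z \<le> K" using z by (simp add: K_def)
      have "(\<lambda>j. c (j + n) * z ^ (j + n)) sums (p z - (\<Sum>j<n. c j * z ^ j))"
        using sums by (rule sums_split_initial_segment)
      then have eq: "p z - (\<Sum>j<n. c j * z ^ j) = (\<Sum>j. c (j + n) * z ^ (j + n))" by (simp add: sums_iff)
      have sm: "summable (\<lambda>j. norm (c (j + n)) * K ^ (j + n))" using smK summable_ignore_initial_segment by blast
      have le: "norm (c (j + n) * z ^ (j + n)) \<le> norm (c (j + n)) * K ^ (j + n)" for j
        using zK by (simp add: norm_mult norm_power mult_left_mono power_mono)
      have "norm (\<Sum>j. c (j + n) * z ^ (j + n)) \<le> (\<Sum>j. norm (c (j + n)) * K ^ (j + n))"
        by (rule norm_suminf_le[OF le sm])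
      then show ?thesis unfolding eq using n by (simp add: abs_less_iff)
    qed
    define s where "s = e / (2 * (real n + 1) * K ^ n)"
    have s: "s > 0" using e K by (simp add: s_def)
    have "\<exists>d\<in>D. d \<in> ball (c j) s" for j using D(2)[of "ball (c j) s"] s by auto
    then obtain d where d: "\<And>j. d j \<in> D" "\<And>j. norm (c j - d j) < s"
      by (metis dist_norm mem_ball)
    define l where "l = map d [0..<n]"
    have "l \<in> lists D" using d by (auto simp: l_def)
    then obtain i where i: "from_nat_into (lists D) i = l"
      using from_nat_into_surj[OF cl] by blast
    define N where "N = prod_encode (i, m)"
    have N: "N \<ge> m" unfolding N_def by (rule le_prod_encode_2)
    have qN: "q N = (\<lambda>z. \<Sum>j<n. d j * z ^ j)"
      by (simp add: q_def N_def i P_def l_def)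
    have "norm (q N z - p z) < e" if z: "norm z \<le> k" for z
    proof -
      have zK: "norm z \<le> K" using z by (simp add: K_def)
      have K1: "K \<ge> 1" by (simp add: K_def)
      have "norm ((\<Sum>j<n. c j * z ^ j) - q N z) = norm (\<Sum>j<n. (c j - d j) * z ^ j)"
        by (simp add: qN sum_subtractf algebra_simps)
      also have "\<dots> \<le> (\<Sum>j<n. s * K ^ n)"
      proof (rule sum_norm_le)
        fix j assume "j \<in> {..<n}"
        then have "norm z ^ j \<le> K ^ n"
          using power_mono[OF zK, of j] power_increasing[of j n K] K1 by simp
        then show "norm ((c j - d j) * z ^ j) \<le> s * K ^ n"
          unfolding norm_mult norm_power using d(2)[of j] s by (intro mult_mono) auto
      qed
      also have "\<dots> = real n / (real n + 1) * (e/2)" using K by (simp add: s_def)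
      also have "\<dots> \<le> 1 * (e/2)" using e by (intro mult_right_mono) auto
      finally have "norm ((\<Sum>j<n. c j * z ^ j) - q N z) \<le> e/2" by simp
      then show ?thesis using tail[OF z]
        norm_triangle_ineq[of "p z - (\<Sum>j<n. c j * z ^ j)" "(\<Sum>j<n. c j * z ^ j) - q N z"]
        by (simp add: norm_minus_commute)
    qed
    with N show "\<exists>n\<ge>m. \<forall>z. norm z \<le> k \<longrightarrow> norm (q n z - p z) < e" by blast
  qed
qed

section \<open>Topology and Borel sets of the space of entire functions\<close>

lemma topspace_entire_topology [simp]: "topspace entire_topology = entire_functions"
proof -
  have "openin entire_topology entire_functions"
    unfolding openin_entire_topology
    by (auto intro!: exI[of _ "{}"] exI[of _ "1::real"])
  then show ?thesis
    unfolding topspace_def by (metis (mono_tags, lifting) Sup_upper openin_entire_topology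
        Sup_least mem_Collect_eq subset_antisym)
qed

lemma entire_continuous_on: "f \<in> entire_functions \<Longrightarrow> continuous_on K f"
  unfolding entire_functions_def
  by (metis continuous_on_subset holomorphic_on_imp_continuous_on mem_Collect_eq subset_UNIV)

text \<open>A strict bound on a compact set holds with room to spare; this is what makes sets defined by strict
  bounds on compact sets open.\<close>

lemma compact_dist_margin:
  assumes K: "compact K" and f: "continuous_on K f" and g: "continuous_on K g"
    and lt: "\<And>z. z \<in> K \<Longrightarrow> dist (f z) (g z) < (e::real)"
  obtains d where "d > 0" "\<And>z. z \<in> K \<Longrightarrow> dist (f z) (g z) + d \<le> e"
proof (cases "K = {}")
  case True
  then show thesis using that[of 1] by simp
next
  case False
  obtain x where x: "x \<in> K" "\<And>z. z \<in> K \<Longrightarrow> dist (f z) (g z) \<le> dist (f x) (g x)"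
    using continuous_attains_sup[OF K False, of "\<lambda>z. dist (f z) (g z)"] f g
    by (metis continuous_on_dist)
  show thesis
    by (rule that[of "e - dist (f x) (g x)"]) (use x lt[OF x(1)] in auto)
qed

lemma openin_entire_translate_ball:
  assumes K: "compact K" and p: "continuous_on UNIV p"
  shows "openin entire_topology {f \<in> entire_functions. \<forall>w\<in>K. dist (p w) (f (w + z)) < e}"
  unfolding openin_entire_topology
proof (intro conjI ballI)
  fix f assume "f \<in> {f \<in> entire_functions. \<forall>w\<in>K. dist (p w) (f (w + z)) < e}"
  then have f: "f \<in> entire_functions" "\<And>w. w \<in> K \<Longrightarrow> dist (p w) (f (w + z)) < e" by auto
  have c: "continuous_on K (\<lambda>w. f (w + z))"
    by (rule continuous_on_compose2[OF entire_continuous_on[OF f(1), of UNIV]])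
      (auto intro!: continuous_intros)
  have cp: "continuous_on K p" using p continuous_on_subset by blast
  obtain d where d: "d > 0" "\<And>w. w \<in> K \<Longrightarrow> dist (p w) (f (w + z)) + d \<le> e"
    using compact_dist_margin[OF K cp c f(2)] by blast
  show "\<exists>L d. compact L \<and> d > 0 \<and> {g \<in> entire_functions. \<forall>z\<in>L. dist (f z) (g z) < d}
      \<subseteq> {f \<in> entire_functions. \<forall>w\<in>K. dist (p w) (f (w + z)) < e}"
  proof (intro exI conjI)
    show "compact ((\<lambda>w. w + z) ` K)" using compact_translation[OF K, of z] by (simp add: add.commute)
    show "d > 0" by fact
    show "{g \<in> entire_functions. \<forall>x\<in>(\<lambda>w. w + z) ` K. dist (f x) (g x) < d}
      \<subseteq> {f \<in> entire_functions. \<forall>w\<in>K. dist (p w) (f (w + z)) < e}"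
    proof clarify
      fix g w assume g: "\<forall>x\<in>(\<lambda>w. w + z) ` K. dist (f x) (g x) < d" and w: "w \<in> K"
      have "dist (p w) (g (w + z)) \<le> dist (p w) (f (w + z)) + dist (f (w + z)) (g (w + z))"
        by (rule dist_triangle)
      moreover have "dist (f (w + z)) (g (w + z)) < d" using g w by blast
      ultimately show "dist (p w) (g (w + z)) < e" using d(2)[OF w] by linarith
    qed
  qed
qed auto

lemma space_entire_borel [simp]: "space entire_borel = entire_functions"
  unfolding entire_borel_def borel_of_topology_def
  by (subst space_measure_of) (auto simp: openin_entire_topology)

lemma sets_entire_borel: "sets entire_borel = sigma_sets entire_functions {U. openin entire_topology U}"
  unfolding entire_borel_def borel_of_topology_def
  by (subst sets_measure_of) (auto simp: openin_entire_topology)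

lemma openin_entire_borel: "openin entire_topology U \<Longrightarrow> U \<in> sets entire_borel"
  unfolding sets_entire_borel by (rule sigma_sets.Basic) simp

lemma translate_entire:
  assumes "f \<in> entire_functions" shows "translate z f \<in> entire_functions"
proof -
  have "(\<lambda>w. w + z) holomorphic_on UNIV" by (intro holomorphic_intros)
  moreover have "f holomorphic_on UNIV" using assms by (simp add: entire_functions_def)
  ultimately show ?thesis
    using holomorphic_on_compose_gen[of "\<lambda>w. w + z" UNIV f UNIV]
    by (simp add: entire_functions_def translate_def o_def)
qed

lemma universal_entire_iff:
  "f \<in> universal_entire \<longleftrightarrow> f \<in> entire_functions \<and>
     (\<forall>p\<in>entire_functions. \<forall>K e. compact K \<longrightarrow> e > 0 \<longrightarrow> (\<exists>z. \<forall>w\<in>K. dist (p w) (f (w + z)) < e))"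
    (is "_ \<longleftrightarrow> ?E \<and> ?R")
proof -
  have "entire_topology closure_of (range (\<lambda>z. translate z f)) = entire_functions \<longleftrightarrow> ?R"
    if f: "f \<in> entire_functions"
  proof
    assume cl: "entire_topology closure_of (range (\<lambda>z. translate z f)) = entire_functions"
    show ?R
    proof (intro ballI allI impI)
      fix p K and e :: real
      assume p: "p \<in> entire_functions" and K: "compact (K :: complex set)" and e: "e > 0"
      define V where "V = {g \<in> entire_functions. \<forall>w\<in>K. dist (p w) (g (w + 0)) < e}"
      have "openin entire_topology V"
        unfolding V_def by (rule openin_entire_translate_ball[OF K entire_continuous_on[OF p]])
      moreover have "p \<in> V" using p e by (simp add: V_def)
      moreover have "p \<in> entire_topology closure_of (range (\<lambda>z. translate z f))" using cl p by simp
      ultimately have "\<exists>g. g \<in> range (\<lambda>z. translate z f) \<and> g \<in> V"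
        unfolding in_closure_of by blast
      then obtain g where "g \<in> range (\<lambda>z. translate z f)" "\<forall>w\<in>K. dist (p w) (g (w + 0)) < e"
        unfolding V_def by blast
      then show "\<exists>z. \<forall>w\<in>K. dist (p w) (f (w + z)) < e" by (auto simp: translate_def)
    qed
  next
    assume R: ?R
    show "entire_topology closure_of (range (\<lambda>z. translate z f)) = entire_functions"
    proof (intro equalityI subsetI)
      fix p assume p: "p \<in> entire_functions"
      show "p \<in> entire_topology closure_of (range (\<lambda>z. translate z f))"
        unfolding in_closure_of
      proof (intro conjI allI impI)
        show "p \<in> topspace entire_topology" using p by simp
        fix U assume "p \<in> U \<and> openin entire_topology U"
        then obtain K e where K: "compact K" "(e::real) > 0"
          "{g \<in> entire_functions. \<forall>z\<in>K. dist (p z) (g z) < e} \<subseteq> U"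
          unfolding openin_entire_topology by blast
        obtain z where "\<forall>w\<in>K. dist (p w) (f (w + z)) < e" using R p K by blast
        then have "translate z f \<in> U" using K(3) translate_entire[OF f, of z] by (auto simp: translate_def)
        then show "\<exists>y. y \<in> range (\<lambda>z. translate z f) \<and> y \<in> U" by blast
      qed
    qed (metis closure_of_subset_topspace subsetD topspace_entire_topology)
  qed
  then show ?thesis unfolding universal_entire_def by auto
qed

lemma translate_measurable: "translate z \<in> measurable entire_borel entire_borel"
proof (rule measurable_sigma_sets[OF sets_entire_borel])
  show "{U. openin entire_topology U} \<subseteq> Pow entire_functions" by (auto simp: openin_entire_topology)
  show "translate z \<in> space entire_borel \<rightarrow> entire_functions" by (simp add: translate_entire)
  fix U assume "U \<in> {U. openin entire_topology U}"
  then have U: "openin entire_topology U" by simp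
  have "openin entire_topology (translate z -` U \<inter> entire_functions)"
    unfolding openin_entire_topology
  proof (intro conjI ballI)
    fix f assume f: "f \<in> translate z -` U \<inter> entire_functions"
    then obtain K e where K: "compact K" "(e::real) > 0"
      "{g \<in> entire_functions. \<forall>x\<in>K. dist (translate z f x) (g x) < e} \<subseteq> U"
      using U unfolding openin_entire_topology by blast
    show "\<exists>K e. compact K \<and> e > 0 \<and> {g \<in> entire_functions. \<forall>z\<in>K. dist (f z) (g z) < e}
        \<subseteq> translate z -` U \<inter> entire_functions"
    proof (intro exI conjI)
      show "compact ((\<lambda>w. w + z) ` K)" using compact_translation[OF K(1), of z] by (simp add: add.commute)
      show "e > 0" by fact
      show "{g \<in> entire_functions. \<forall>x\<in>(\<lambda>w. w + z) ` K. dist (f x) (g x) < e}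
          \<subseteq> translate z -` U \<inter> entire_functions"
      proof safe
        fix g assume g: "g \<in> entire_functions" "\<forall>x\<in>(\<lambda>w. w + z) ` K. dist (f x) (g x) < e"
        then have "translate z g \<in> {g \<in> entire_functions. \<forall>x\<in>K. dist (translate z f x) (g x) < e}"
          using translate_entire[OF g(1)] by (auto simp: translate_def)
        then show "g \<in> translate z -` U" using K(3) by auto
      qed
    qed
  qed auto
  then show "translate z -` U \<inter> space entire_borel \<in> sets entire_borel"
    using openin_entire_borel by simp
qed

text \<open>The Borel structure of the space of entire functions is generated by point evaluations. By
  separability every open set is a union of countably many sets of the form
  \<open>|f - q\<^sub>i| \<le> 1 / (m + 1)\<close> on the open ball of radius \<open>k\<close>, and by continuity such a condition need
  only be tested at the points of a countable dense set.\<close>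

lemma measurable_into_entire_borel:
  assumes range: "\<And>x. x \<in> space M \<Longrightarrow> h x \<in> entire_functions"
    and meas: "\<And>z. (\<lambda>x. h x z) \<in> borel_measurable M"
  shows "h \<in> measurable M entire_borel"
proof -
  obtain q :: "nat \<Rightarrow> complex \<Rightarrow> complex" where q: "\<And>n. q n holomorphic_on UNIV"
    "\<And>p k e m. p holomorphic_on UNIV \<Longrightarrow> (e::real) > 0 \<Longrightarrow> \<exists>n\<ge>m. \<forall>z. norm z \<le> k \<longrightarrow> norm (q n z - p z) < e"
    using entire_dense_sequence by blast
  obtain D :: "complex set" where D: "countable D" "\<And>X. open X \<Longrightarrow> X \<noteq> {} \<Longrightarrow> \<exists>d\<in>D. d \<in> X"
    using countable_dense_exists by blast
  define N where "N = (\<lambda>(i, k, m). {f \<in> entire_functions. \<forall>z\<in>D \<inter> ball 0 (real k). dist (f z) (q i z) \<le> 1 / (real m + 1)})"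
  show ?thesis
  proof (rule measurable_sigma_sets[OF sets_entire_borel])
    show "{U. openin entire_topology U} \<subseteq> Pow entire_functions" by (auto simp: openin_entire_topology)
    show "h \<in> space M \<rightarrow> entire_functions" using range by simp
    fix U assume "U \<in> {U. openin entire_topology U}"
    then have U: "openin entire_topology U" by simp
    have U_eq: "U = (\<Union>t\<in>{t. N t \<subseteq> U}. N t)"
    proof (intro equalityI subsetI)
      fix f assume f: "f \<in> U"
      then have fe: "f \<in> entire_functions" using U unfolding openin_entire_topology by blast
      obtain K e where K: "compact K" "(e::real) > 0"
        "{g \<in> entire_functions. \<forall>z\<in>K. dist (f z) (g z) < e} \<subseteq> U"
        using U f unfolding openin_entire_topology by blast
      obtain r where r: "\<And>z. z \<in> K \<Longrightarrow> norm z \<le> r"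
        using compact_imp_bounded[OF K(1)] unfolding bounded_iff by blast
      obtain k where k: "r < real k" using reals_Archimedean2 by blast
      obtain m where m: "1 / (real m + 1) < e / 2"
        using reals_Archimedean[of "e/2"] K(2) by (auto simp: inverse_eq_divide add.commute)
      have "f holomorphic_on UNIV" using fe by (simp add: entire_functions_def)
      from q(2)[OF this, of "1 / (real m + 1)" 0 "real k"]
      obtain i where i: "\<And>z. norm z \<le> real k \<Longrightarrow> norm (q i z - f z) < 1 / (real m + 1)" by auto
      have "f \<in> N (i, k, m)"
        using fe i unfolding N_def by (auto simp: dist_norm norm_minus_commute less_imp_le)
      moreover have "N (i, k, m) \<subseteq> U"
      proof
        fix g assume g: "g \<in> N (i, k, m)"
        then have ge: "g \<in> entire_functions" by (simp add: N_def)
        have close: "dist (g z) (q i z) \<le> 1 / (real m + 1)" if z: "z \<in> ball 0 (real k)" for z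
        proof (rule ccontr)
          assume "\<not> dist (g z) (q i z) \<le> 1 / (real m + 1)"
          define V where "V = {w. 1 / (real m + 1) < dist (g w) (q i w)} \<inter> ball 0 (real k)"
          have "open V" unfolding V_def
            using entire_continuous_on[OF ge, of UNIV] holomorphic_on_imp_continuous_on[OF q(1)]
            by (intro open_Int open_Collect_less continuous_intros open_ball) auto
          moreover have "z \<in> V" using z \<open>\<not> _\<close> by (simp add: V_def)
          ultimately obtain d where d: "d \<in> D" "d \<in> V" using D(2) by blast
          then have "dist (g d) (q i d) \<le> 1 / (real m + 1)" using g by (auto simp: N_def V_def)
          then show False using d(2) by (simp add: V_def)
        qed
        have "dist (f z) (g z) < e" if z: "z \<in> K" for z
        proof -
          have zk: "z \<in> ball 0 (real k)" "norm z \<le> real k" using r[OF z] k by auto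
          have "dist (f z) (q i z) < e/2" using i[OF zk(2)] m by (simp add: dist_norm norm_minus_commute)
          moreover have "dist (g z) (q i z) < e/2" using close[OF zk(1)] m by linarith
          ultimately show ?thesis by (metis dist_triangle_half_l dist_commute)
        qed
        then show "g \<in> U" using K(3) ge by blast
      qed
      ultimately show "f \<in> (\<Union>t\<in>{t. N t \<subseteq> U}. N t)" by blast
    qed blast
    have N: "h -` N t \<inter> space M \<in> sets M" for t
    proof (cases t)
      case (fields i k m)
      have "{x \<in> space M. \<forall>z\<in>D \<inter> ball 0 (real k). dist (h x z) (q i z) \<le> 1 / (real m + 1)} \<in> sets M"
      proof (rule sets.sets_Collect_countable_All')
        show "{x \<in> space M. dist (h x z) (q i z) \<le> 1 / (real m + 1)} \<in> sets M" for z
          using meas[of z] by measurable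
      qed (use D(1) in blast)
      moreover have "h -` N t \<inter> space M = {x \<in> space M. \<forall>z\<in>D \<inter> ball 0 (real k). dist (h x z) (q i z) \<le> 1 / (real m + 1)}"
        using range by (auto simp: N_def fields)
      ultimately show ?thesis by simp
    qed
    have "h -` U \<inter> space M = (\<Union>t\<in>{t. N t \<subseteq> U}. h -` N t \<inter> space M)"
      by (subst U_eq) auto
    moreover have "(\<Union>t\<in>{t. N t \<subseteq> U}. h -` N t \<inter> space M) \<in> sets M"
      by (intro sets.countable_UN' countableI_type image_subsetI N)
    ultimately show "h -` U \<inter> space M \<in> sets M" by simp
  qed
qed

text \<open>The universal functions form a countable intersection of open sets, as it suffices to approximate
  the members of a countable dense sequence on balls of integer radius.\<close>

lemma universal_entire_sets: "universal_entire \<in> sets entire_borel"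
proof -
  obtain q :: "nat \<Rightarrow> complex \<Rightarrow> complex" where q: "\<And>n. q n holomorphic_on UNIV"
    "\<And>p k e m. p holomorphic_on UNIV \<Longrightarrow> (e::real) > 0 \<Longrightarrow> \<exists>n\<ge>m. \<forall>z. norm z \<le> k \<longrightarrow> norm (q n z - p z) < e"
    using entire_dense_sequence by blast
  have qe: "q n \<in> entire_functions" for n using q(1) by (simp add: entire_functions_def)
  define W where "W i k m z = {f \<in> entire_functions. \<forall>w\<in>cball 0 (real k). dist (q i w) (f (w + z)) < 1 / (real m + 1)}"
    for i k m z
  have "openin entire_topology (W i k m z)" for i k m z
    unfolding W_def by (rule openin_entire_translate_ball[OF compact_cball entire_continuous_on[OF qe]])
  then have "openin entire_topology (\<Union>z. W i k m z)" for i k m by blast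
  then have "(\<Inter>i. \<Inter>k. \<Inter>m. \<Union>z. W i k m z) \<in> sets entire_borel"
    by (intro sets.countable_INT image_subsetI openin_entire_borel) auto
  moreover have "universal_entire = (\<Inter>i. \<Inter>k. \<Inter>m. \<Union>z. W i k m z)"
  proof (intro equalityI subsetI)
    fix f assume "f \<in> universal_entire"
    then have f: "f \<in> entire_functions"
      "\<And>p K e. p\<in>entire_functions \<Longrightarrow> compact K \<Longrightarrow> e > 0 \<Longrightarrow> (\<exists>z. \<forall>w\<in>K. dist (p w) (f (w + z)) < e)"
      unfolding universal_entire_iff by auto
    have "\<exists>z. f \<in> W i k m z" for i k m
      using f(2)[OF qe compact_cball, of "1 / (real m + 1)" 0 "real k" i] f(1) unfolding W_def by auto
    then show "f \<in> (\<Inter>i. \<Inter>k. \<Inter>m. \<Union>z. W i k m z)" by blast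
  next
    fix f assume f: "f \<in> (\<Inter>i. \<Inter>k. \<Inter>m. \<Union>z. W i k m z)"
    show "f \<in> universal_entire" unfolding universal_entire_iff
    proof (intro conjI ballI allI impI)
      show "f \<in> entire_functions" using f by (auto simp: W_def)
      fix p K and e :: real
      assume p: "p \<in> entire_functions" and K: "compact (K :: complex set)" and e: "e > 0"
      obtain r where r: "\<And>z. z \<in> K \<Longrightarrow> norm z \<le> r"
        using compact_imp_bounded[OF K(1)] unfolding bounded_iff by blast
      obtain k where k: "r < real k" using reals_Archimedean2 by blast
      obtain m where m: "1 / (real m + 1) < e / 2"
        using reals_Archimedean[of "e/2"] e by (auto simp: inverse_eq_divide add.commute)
      have "p holomorphic_on UNIV" using p by (simp add: entire_functions_def)
      from q(2)[OF this, of "e/2" 0 "real k"] e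
      obtain i where i: "\<And>z. norm z \<le> real k \<Longrightarrow> norm (q i z - p z) < e/2" by auto
      obtain z where z: "f \<in> W i k m z" using f by blast
      have "dist (p w) (f (w + z)) < e" if w: "w \<in> K" for w
      proof -
        have wk: "w \<in> cball 0 (real k)" "norm w \<le> real k" using r[OF w] k by auto
        have "dist (q i w) (f (w + z)) < e/2" using z wk(1) m unfolding W_def by force
        moreover have "dist (q i w) (p w) < e/2" using i[OF wk(2)] by (simp add: dist_norm)
        ultimately show ?thesis using dist_triangle_half_r by blast
      qed
      then show "\<exists>z. \<forall>w\<in>K. dist (p w) (f (w + z)) < e" by blast
    qed
  qed
  ultimately show ?thesis by simp
qed

section \<open>Lattices of scaled Gaussian integers\<close>

definition gaussian_lattice :: "nat \<Rightarrow> complex set" where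
  "gaussian_lattice R = {of_nat R * Complex (of_int a) (of_int b) | a b :: int. True}"

lemma gaussian_lattice_iff:
  "z \<in> gaussian_lattice N \<longleftrightarrow> (\<exists>a b :: int. Re z = of_int a * real N \<and> Im z = of_int b * real N)"
  unfolding gaussian_lattice_def by (auto simp: complex_eq_iff mult.commute)

lemma gaussian_lattice_0 [simp]: "0 \<in> gaussian_lattice N"
  unfolding gaussian_lattice_iff by (intro exI[of _ 0]) auto

lemma gaussian_lattice_add:
  assumes "z \<in> gaussian_lattice N" "w \<in> gaussian_lattice N" shows "z + w \<in> gaussian_lattice N"
proof -
  obtain a b c d :: int where "Re z = of_int a * real N" "Im z = of_int b * real N"
    "Re w = of_int c * real N" "Im w = of_int d * real N"
    using assms unfolding gaussian_lattice_iff by blast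
  then show ?thesis unfolding gaussian_lattice_iff
    by (intro exI[of _ "a + c"] exI[of _ "b + d"]) (simp add: algebra_simps)
qed

lemma gaussian_lattice_minus:
  assumes "z \<in> gaussian_lattice N" shows "- z \<in> gaussian_lattice N"
proof -
  obtain a b :: int where "Re z = of_int a * real N" "Im z = of_int b * real N"
    using assms unfolding gaussian_lattice_iff by blast
  then show ?thesis unfolding gaussian_lattice_iff
    by (intro exI[of _ "- a"] exI[of _ "- b"]) simp
qed

lemma gaussian_lattice_diff:
  "z \<in> gaussian_lattice N \<Longrightarrow> w \<in> gaussian_lattice N \<Longrightarrow> z - w \<in> gaussian_lattice N"
  using gaussian_lattice_add[OF _ gaussian_lattice_minus] by fastforce

lemma gaussian_lattice_commute: "z - w \<in> gaussian_lattice N \<longleftrightarrow> w - z \<in> gaussian_lattice N"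
  using gaussian_lattice_minus[of "z - w" N] gaussian_lattice_minus[of "w - z" N] by auto

lemma gaussian_lattice_dvd:
  assumes "z \<in> gaussian_lattice N" "M dvd N" shows "z \<in> gaussian_lattice M"
proof -
  obtain k where k: "N = M * k" using assms(2) by blast
  obtain a b :: int where "Re z = of_int a * real N" "Im z = of_int b * real N"
    using assms unfolding gaussian_lattice_iff by blast
  then show ?thesis unfolding gaussian_lattice_iff k
    by (intro exI[of _ "a * int k"] exI[of _ "b * int k"]) simp
qed

lemma gaussian_latticeE:
  assumes "z \<in> gaussian_lattice R"
  obtains a b :: int where "Re z = of_int a * real R" "Im z = of_int b * real R"
proof -
  obtain a b :: int where "z = of_nat R * Complex (of_int a) (of_int b)"
    using assms unfolding gaussian_lattice_def by blast
  then show thesis by (intro that[of a b]) simp_all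
qed

lemma square_rep_exists:
  assumes "N > 0"
  shows "\<exists>w. w - z \<in> gaussian_lattice N \<and> 0 \<le> Re w \<and> Re w < real N \<and> 0 \<le> Im w \<and> Im w < real N"
proof -
  have fr: "0 \<le> t - of_int \<lfloor>t / real N\<rfloor> * real N" "t - of_int \<lfloor>t / real N\<rfloor> * real N < real N" for t :: real
  proof -
    have N: "real N > 0" using assms by simp
    have "of_int \<lfloor>t / real N\<rfloor> \<le> t / real N" "t / real N < of_int \<lfloor>t / real N\<rfloor> + 1" by linarith+
    then show "0 \<le> t - of_int \<lfloor>t / real N\<rfloor> * real N" "t - of_int \<lfloor>t / real N\<rfloor> * real N < real N"
      unfolding pos_le_divide_eq[OF N] pos_divide_less_eq[OF N] by (simp_all add: algebra_simps)
  qed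
  define w where "w = Complex (Re z - of_int \<lfloor>Re z / real N\<rfloor> * real N) (Im z - of_int \<lfloor>Im z / real N\<rfloor> * real N)"
  have "w - z \<in> gaussian_lattice N"
    unfolding gaussian_lattice_iff w_def
    by (intro exI[of _ "- \<lfloor>Re z / real N\<rfloor>"] exI[of _ "- \<lfloor>Im z / real N\<rfloor>"]) simp
  then show ?thesis using fr[of "Re z"] fr[of "Im z"] by (intro exI[of _ w]) (simp add: w_def)
qed

lemma square_rep_unique:
  assumes "z - w \<in> gaussian_lattice N"
    "0 \<le> Re z" "Re z < real N" "0 \<le> Im z" "Im z < real N"
    "0 \<le> Re w" "Re w < real N" "0 \<le> Im w" "Im w < real N"
  shows "z = w"
proof -
  obtain a b :: int where ab: "Re (z - w) = of_int a * real N" "Im (z - w) = of_int b * real N"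
    using gaussian_latticeE[OF assms(1)] by blast
  have zero: "c = 0" if "\<bar>of_int c * real N\<bar> < real N" for c :: int
  proof -
    have N: "real N > 0" using that by linarith
    have "\<bar>of_int c\<bar> * real N < 1 * real N" using that by (simp add: abs_mult)
    then have "\<bar>of_int c :: real\<bar> < 1" using N by (rule mult_right_less_imp_less[OF _ less_imp_le])
    then show ?thesis by linarith
  qed
  have "a = 0" "b = 0" using ab assms by (auto intro!: zero simp flip: ab)
  then show ?thesis using ab by (simp add: complex_eq_iff)
qed

text \<open>How the index of a cell moves: shifting \<open>t\<close> by an integer number \<open>c\<close> of cells and reducing modulo
  the period \<open>K\<close> does the same to the floor.\<close>

lemma floor_add_mod:
  fixes s t :: real and c i :: int and K :: nat
  assumes "s = t + of_int c + of_int i * real K" "0 \<le> s" "s < real K"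
  shows "\<lfloor>s\<rfloor> = (\<lfloor>t\<rfloor> + c) mod int K"
proof -
  have "s = t + of_int (c + i * int K)" using assms by simp
  then have fl: "\<lfloor>s\<rfloor> = \<lfloor>t\<rfloor> + c + i * int K" by (metis floor_add_int add.assoc)
  have "0 \<le> \<lfloor>s\<rfloor>" "\<lfloor>s\<rfloor> < int K" using assms(2,3) by (simp_all add: floor_less_iff)
  then have "\<lfloor>s\<rfloor> = \<lfloor>s\<rfloor> mod int K" by simp
  also have "\<dots> = (\<lfloor>t\<rfloor> + c) mod int K" unfolding fl by simp
  finally show ?thesis .
qed

section \<open>Flows with square coordinates\<close>

text \<open>What the argument needs of the solenoid: a probability space with a measure-preserving action of
  the plane, and for each \<open>n\<close> the representative \<open>X n g\<close> in the square of side \<open>R n\<close>, equivariant and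
  compatible between levels modulo the lattices. The last assumption says that the cells of side
  \<open>2\<^sup>-\<^sup>n\<close> generate all events.\<close>

locale solenoidal_flow = prob_space M for M :: "'g measure" +
  fixes act :: "complex \<Rightarrow> 'g \<Rightarrow> 'g" and R :: "nat \<Rightarrow> nat" and X :: "nat \<Rightarrow> 'g \<Rightarrow> complex"
  assumes R_pos: "\<And>n. R n > 0"
    and R_dvd: "\<And>n. R n dvd R (Suc n)"
    and act_measurable [measurable]: "\<And>z. act z \<in> measurable M M"
    and act_preserving: "\<And>z. distr M M (act z) = M"
    and act_act: "\<And>w z g. g \<in> space M \<Longrightarrow> act w (act z g) = act (w + z) g"
    and X_measurable [measurable]: "\<And>n. X n \<in> borel_measurable M"
    and X_range: "\<And>n g. g \<in> space M \<Longrightarrow> 0 \<le> Re (X n g) \<and> Re (X n g) < real (R n) \<and>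
                   0 \<le> Im (X n g) \<and> Im (X n g) < real (R n)"
    and X_act: "\<And>n z g. g \<in> space M \<Longrightarrow> X n (act z g) - (X n g + z) \<in> gaussian_lattice (R n)"
    and X_bond: "\<And>n g. g \<in> space M \<Longrightarrow> X (Suc n) g - X n g \<in> gaussian_lattice (R n)"
    and sets_generated: "sets M = sigma_sets (space M)
      (range (\<lambda>(n, a, b). {g \<in> space M. \<lfloor>2 ^ n * Re (X n g)\<rfloor> = a \<and> \<lfloor>2 ^ n * Im (X n g)\<rfloor> = b}))"
begin

definition cell :: "real \<Rightarrow> nat \<Rightarrow> int \<times> int \<Rightarrow> 'g set" where
  "cell s n v = {g \<in> space M. \<lfloor>s * Re (X n g)\<rfloor> = fst v \<and> \<lfloor>s * Im (X n g)\<rfloor> = snd v}"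

lemma act_space: "g \<in> space M \<Longrightarrow> act z g \<in> space M"
  using act_measurable measurable_space by fast

lemma cell_sets [measurable]: "cell s n v \<in> sets M"
  unfolding cell_def by measurable

text \<open>Any two cells of one grid are carried to each other by the vector between their corners.\<close>

lemma cell_act:
  assumes s: "s > 0" "s * real (R n) = real K"
    and v: "v \<in> {0..<int K} \<times> {0..<int K}" and w: "w \<in> {0..<int K} \<times> {0..<int K}"
  obtains z where "cell s n v = act z -` cell s n w \<inter> space M"
proof -
  define z where "z = Complex (of_int (fst w - fst v) / s) (of_int (snd w - snd v) / s)"
  have "g \<in> cell s n v \<longleftrightarrow> act z g \<in> cell s n w" if g: "g \<in> space M" for g
  proof -
    obtain i j where ij: "Re (X n (act z g) - (X n g + z)) = of_int i * real (R n)"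
      "Im (X n (act z g) - (X n g + z)) = of_int j * real (R n)"
      using gaussian_latticeE[OF X_act[OF g]] by blast
    have "s * Re (X n (act z g)) = s * Re (X n g) + of_int (fst w - fst v) + of_int i * real K"
      "s * Im (X n (act z g)) = s * Im (X n g) + of_int (snd w - snd v) + of_int j * real K"
      using ij s unfolding s(2)[symmetric] z_def by (simp_all add: field_simps)
    moreover have "0 \<le> s * Re (X n (act z g))" "s * Re (X n (act z g)) < real K"
      "0 \<le> s * Im (X n (act z g))" "s * Im (X n (act z g)) < real K"
      using X_range[OF act_space[OF g], of n z] s(1) unfolding s(2)[symmetric] by simp_all
    ultimately have fl: "\<lfloor>s * Re (X n (act z g))\<rfloor> = (\<lfloor>s * Re (X n g)\<rfloor> + (fst w - fst v)) mod int K"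
      "\<lfloor>s * Im (X n (act z g))\<rfloor> = (\<lfloor>s * Im (X n g)\<rfloor> + (snd w - snd v)) mod int K"
      by (intro floor_add_mod; simp)+
    have rg: "0 \<le> \<lfloor>s * Re (X n g)\<rfloor>" "\<lfloor>s * Re (X n g)\<rfloor> < int K" "0 \<le> \<lfloor>s * Im (X n g)\<rfloor>" "\<lfloor>s * Im (X n g)\<rfloor> < int K"
      using X_range[OF g, of n] s(1) by (simp_all add: floor_less_iff flip: s(2))
    have mod_shift: "x = b \<longleftrightarrow> (x + (c - b)) mod k = c"
      if "0 \<le> x" "x < k" "0 \<le> b" "b < k" "0 \<le> c" "c < k" for x b c k :: int
    proof
      assume "(x + (c - b)) mod k = c"
      then have "(x + (c - b)) mod k = c mod k" using that by simp
      then have "(x + (c - b) - (c - b)) mod k = (c - (c - b)) mod k" by (metis mod_diff_left_eq)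
      then show "x = b" using that by simp
    qed (use that in simp)
    show ?thesis
      using mod_shift[OF rg(1,2), of "fst v" "fst w"] mod_shift[OF rg(3,4), of "snd v" "snd w"] v w g act_space[OF g]
      by (auto simp: cell_def fl)
  qed
  then have "cell s n v = act z -` cell s n w \<inter> space M" by (auto simp: cell_def)
  then show thesis by (rule that)
qed

lemma prob_act: "A \<in> sets M \<Longrightarrow> prob (act z -` A \<inter> space M) = prob A"
  using act_preserving[of z] measure_distr[OF act_measurable, of A z] by simp

text \<open>The \<open>K\<^sup>2\<close> cells of a grid partition the space and are translates of one another. As \<open>B\<close> is
  invariant, it meets all of them in sets of equal probability.\<close>

lemma prob_Int_cell:
  assumes s: "s > 0" "s * real (R n) = real K" and B: "B \<in> sets M"
    and inv: "\<And>z. AE g in M. act z g \<in> B \<longleftrightarrow> g \<in> B"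
    and w: "w \<in> {0..<int K} \<times> {0..<int K}"
  shows "prob (B \<inter> cell s n w) = prob B / real K ^ 2"
proof -
  let ?I = "{0..<int K} \<times> {0..<int K}"
  have eq: "prob (B \<inter> cell s n v) = prob (B \<inter> cell s n w)" if v: "v \<in> ?I" for v
  proof -
    obtain z where z: "cell s n v = act z -` cell s n w \<inter> space M" using cell_act[OF s v w] by blast
    have "prob (B \<inter> cell s n v) = prob (act z -` (B \<inter> cell s n w) \<inter> space M)"
      unfolding z using inv[of z] B
      by (intro finite_measure_eq_AE) (auto elim!: eventually_mono)
    also have "\<dots> = prob (B \<inter> cell s n w)" using B by (intro prob_act) auto
    finally show ?thesis .
  qed
  have "B = (\<Union>v\<in>?I. B \<inter> cell s n v)"
  proof -
    have "g \<in> (\<Union>v\<in>?I. cell s n v)" if g: "g \<in> space M" for g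
    proof -
      have "0 \<le> \<lfloor>s * Re (X n g)\<rfloor>" "\<lfloor>s * Re (X n g)\<rfloor> < int K" "0 \<le> \<lfloor>s * Im (X n g)\<rfloor>" "\<lfloor>s * Im (X n g)\<rfloor> < int K"
        using X_range[OF g, of n] s(1) by (simp_all add: floor_less_iff flip: s(2))
      then show ?thesis using g
        by (intro UN_I[of "(\<lfloor>s * Re (X n g)\<rfloor>, \<lfloor>s * Im (X n g)\<rfloor>)"]) (auto simp: cell_def)
    qed
    then show ?thesis using sets.sets_into_space[OF B] by blast
  qed
  then have "prob B = prob (\<Union>v\<in>?I. B \<inter> cell s n v)" by simp
  also have "\<dots> = (\<Sum>v\<in>?I. prob (B \<inter> cell s n v))"
    using B by (intro finite_measure_finite_Union) (auto simp: disjoint_family_on_def cell_def prod_eq_iff)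
  also have "\<dots> = real (card ?I) * prob (B \<inter> cell s n w)" using eq by simp
  also have "real (card ?I) = real K ^ 2" by (simp add: power2_eq_square)
  finally show ?thesis using w by (auto simp: field_simps)
qed

lemma prob_cell:
  assumes s: "s > 0" "s * real (R n) = real K" and w: "w \<in> {0..<int K} \<times> {0..<int K}"
  shows "prob (cell s n w) = 1 / real K ^ 2"
proof -
  have "prob (space M \<inter> cell s n w) = prob (space M) / real K ^ 2"
    by (rule prob_Int_cell[OF s _ _ w]) (auto simp: act_space)
  moreover have "space M \<inter> cell s n w = cell s n w" by (auto simp: cell_def)
  ultimately show ?thesis by (simp add: prob_space)
qed

text \<open>Half of the finer index, reduced modulo the number of cells per side, is the coarser index.
  Hence the dyadic partitions are nested.\<close>

lemma cell_refine:
  assumes g: "g \<in> space M" "g' \<in> space M"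
    and eq: "\<lfloor>2 ^ (Suc n) * Re (X (Suc n) g)\<rfloor> = \<lfloor>2 ^ (Suc n) * Re (X (Suc n) g')\<rfloor>"
      "\<lfloor>2 ^ (Suc n) * Im (X (Suc n) g)\<rfloor> = \<lfloor>2 ^ (Suc n) * Im (X (Suc n) g')\<rfloor>"
  shows "\<lfloor>2 ^ n * Re (X n g)\<rfloor> = \<lfloor>2 ^ n * Re (X n g')\<rfloor> \<and> \<lfloor>2 ^ n * Im (X n g)\<rfloor> = \<lfloor>2 ^ n * Im (X n g')\<rfloor>"
proof -
  have half: "\<lfloor>2 ^ n * t\<rfloor> = \<lfloor>2 ^ (Suc n) * t\<rfloor> div 2" for t :: real
    using floor_divide_real_eq_div[of 2 "2 ^ Suc n * t"] by simp
  have "\<lfloor>2 ^ n * Re (X n g)\<rfloor> = (\<lfloor>2 ^ (Suc n) * Re (X (Suc n) g)\<rfloor> div 2) mod int (2 ^ n * R n) \<and>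
    \<lfloor>2 ^ n * Im (X n g)\<rfloor> = (\<lfloor>2 ^ (Suc n) * Im (X (Suc n) g)\<rfloor> div 2) mod int (2 ^ n * R n)"
    if g: "g \<in> space M" for g
  proof -
    obtain i j where ij: "Re (X (Suc n) g - X n g) = of_int i * real (R n)"
      "Im (X (Suc n) g - X n g) = of_int j * real (R n)"
      using gaussian_latticeE[OF X_bond[OF g]] by blast
    have "2 ^ n * Re (X n g) = 2 ^ n * Re (X (Suc n) g) + of_int 0 + of_int (-i) * real (2 ^ n * R n)"
      "2 ^ n * Im (X n g) = 2 ^ n * Im (X (Suc n) g) + of_int 0 + of_int (-j) * real (2 ^ n * R n)"
      using ij by (simp_all add: algebra_simps)
    moreover have "0 \<le> 2 ^ n * Re (X n g)" "2 ^ n * Re (X n g) < real (2 ^ n * R n)"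
       "0 \<le> 2 ^ n * Im (X n g)" "2 ^ n * Im (X n g) < real (2 ^ n * R n)"
      using X_range[OF g, of n] by simp_all
    ultimately show ?thesis unfolding half[symmetric]
      by (metis floor_add_mod add.right_neutral)
  qed
  with g eq show ?thesis by metis
qed

lemma cell_refine_le:
  assumes g: "g \<in> space M" "g' \<in> space M" and "n \<le> m"
    and "\<lfloor>2 ^ m * Re (X m g)\<rfloor> = \<lfloor>2 ^ m * Re (X m g')\<rfloor>" "\<lfloor>2 ^ m * Im (X m g)\<rfloor> = \<lfloor>2 ^ m * Im (X m g')\<rfloor>"
  shows "\<lfloor>2 ^ n * Re (X n g)\<rfloor> = \<lfloor>2 ^ n * Re (X n g')\<rfloor> \<and> \<lfloor>2 ^ n * Im (X n g)\<rfloor> = \<lfloor>2 ^ n * Im (X n g')\<rfloor>"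
  using assms(3,4,5)
proof (induction rule: dec_induct)
  case (step m)
  then show ?case using cell_refine[OF g] by blast
qed simp

text \<open>Two cells of a nested sequence of partitions are either disjoint or comparable.\<close>

lemma Int_stable_cells: "Int_stable (range (\<lambda>(n, v). cell (2 ^ n) n v))"
proof -
  have le: "cell (2 ^ n) n v \<inter> cell (2 ^ m) m w \<in> range (\<lambda>(n, v). cell (2 ^ n) n v)" if "n \<le> m" for n m v w
  proof (cases "cell (2 ^ n) n v \<inter> cell (2 ^ m) m w = {}")
    case True
    \<comment> \<open>The empty set is itself a cell, with an index outside the square.\<close>
    have "cell (2 ^ 0) 0 (-1, -1) = {}"
    proof (rule equals0I)
      fix g assume "g \<in> cell (2 ^ 0) 0 (-1, -1)"
      then have "g \<in> space M" "\<lfloor>Re (X 0 g)\<rfloor> = -1" by (simp_all add: cell_def)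
      then show False using X_range[of g 0] by (simp add: floor_eq_iff)
    qed
    then show ?thesis using True by (intro image_eqI[of _ _ "(0, -1, -1)"]) auto
  next
    case False
    then obtain h where h: "h \<in> cell (2 ^ n) n v" "h \<in> cell (2 ^ m) m w" by blast
    have "cell (2 ^ m) m w \<subseteq> cell (2 ^ n) n v"
    proof
      fix g assume "g \<in> cell (2 ^ m) m w"
      then show "g \<in> cell (2 ^ n) n v"
        using h cell_refine_le[OF _ _ that, of g h] unfolding cell_def by auto
    qed
    then have "cell (2 ^ n) n v \<inter> cell (2 ^ m) m w = cell (2 ^ m) m w" by blast
    then show ?thesis by force
  qed
  show ?thesis
  proof (rule Int_stableI)
    fix a b assume "a \<in> range (\<lambda>(n, v). cell (2 ^ n) n v)" "b \<in> range (\<lambda>(n, v). cell (2 ^ n) n v)"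
    then obtain n v m w where "a = cell (2 ^ n) n v" "b = cell (2 ^ m) m w" by auto
    then show "a \<inter> b \<in> range (\<lambda>(n, v). cell (2 ^ n) n v)"
      using le[of n m v w] le[of m n w v] by (metis Int_commute nle_le)
  qed
qed

text \<open>Ergodicity. An invariant event is independent of every dyadic cell, hence of the sigma-algebra
  that they generate, hence of itself.\<close>

lemma invariant_prob_0_or_1:
  assumes B: "B \<in> sets M" and inv: "\<And>z. AE g in M. act z g \<in> B \<longleftrightarrow> g \<in> B"
  shows "prob B = 0 \<or> prob B = 1"
proof -
  let ?E = "range (\<lambda>(n, v). cell (2 ^ n) n v)"
  have gen: "sets M = sigma_sets (space M) ?E"
    unfolding sets_generated cell_def by (simp add: split_def)
  have indep: "prob (B \<inter> cell (2 ^ n) n v) = prob B * prob (cell (2 ^ n) n v)" for n v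
  proof (cases "v \<in> {0..<int (2 ^ n * R n)} \<times> {0..<int (2 ^ n * R n)}")
    case True
    show ?thesis
      using prob_Int_cell[OF _ _ B inv True, of "2 ^ n" n] prob_cell[OF _ _ True, of "2 ^ n" n] by simp
  next
    case False
    have "cell (2 ^ n) n v = {}"
    proof (rule equals0I)
      fix g assume g: "g \<in> cell (2 ^ n) n v"
      then have "0 \<le> 2 ^ n * Re (X n g)" "2 ^ n * Re (X n g) < real_of_int (int (2 ^ n * R n))"
       "0 \<le> 2 ^ n * Im (X n g)" "2 ^ n * Im (X n g) < real_of_int (int (2 ^ n * R n))"
        using X_range[of g n] by (simp_all add: cell_def)
      then have "0 \<le> \<lfloor>2 ^ n * Re (X n g)\<rfloor>" "\<lfloor>2 ^ n * Re (X n g)\<rfloor> < int (2 ^ n * R n)"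
        "0 \<le> \<lfloor>2 ^ n * Im (X n g)\<rfloor>" "\<lfloor>2 ^ n * Im (X n g)\<rfloor> < int (2 ^ n * R n)"
        unfolding floor_less_iff by simp_all
      then show False using g False by (cases v) (auto simp: cell_def)
    qed
    then show ?thesis by simp
  qed
  have "indep_set {B} ?E"
    unfolding indep_sets2_eq using B indep by auto
  moreover have "Int_stable {B}" by (simp add: Int_stable_def)
  ultimately have "indep_set (sigma_sets (space M) {B}) (sigma_sets (space M) ?E)"
    using Int_stable_cells by (rule indep_set_sigma_sets)
  moreover have "B \<in> sigma_sets (space M) {B}" by (rule sigma_sets.Basic) simp
  ultimately have "prob (B \<inter> B) = prob B * prob B"
    using B unfolding gen by (intro indep_setD)
  then show ?thesis by simp
qed

end

section \<open>Orbits that stay away from the boundaries of the squares\<close>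

context solenoidal_flow
begin

text \<open>Three tiles of side \<open>R n\<close> leave room for a move by \<open>2 R n\<close> in each coordinate that still ends in the
  core.\<close>

definition deep :: "nat \<Rightarrow> 'g set" where
  "deep n = {g \<in> space M. 3 * real (R n) \<le> Re (X (Suc n) g) \<and> Re (X (Suc n) g) \<le> real (R (Suc n)) - 3 * real (R n) \<and>
      3 * real (R n) \<le> Im (X (Suc n) g) \<and> Im (X (Suc n) g) \<le> real (R (Suc n)) - 3 * real (R n)}"

lemma deep_sets [measurable]: "deep n \<in> sets M"
  unfolding deep_def by measurable

text \<open>In the grid of cells of side \<open>R n\<close>, with \<open>K = R (Suc n) / R n\<close> cells per side, a point that is
  not deep lies in one of six rows or six columns, that is, in at most \<open>12 K\<close> of the \<open>K\<^sup>2\<close> cells.\<close>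

lemma prob_not_deep: "prob (space M - deep n) \<le> 12 * (real (R n) / real (R (Suc n)))"
proof -
  define K where "K = R (Suc n) div R n"
  have RK: "R (Suc n) = K * R n" using R_dvd[of n] by (simp add: K_def)
  have K0: "K > 0" using R_pos[of "Suc n"] RK by (cases K) auto
  define s where "s = 1 / real (R n)"
  have s: "s > 0" "s * real (R (Suc n)) = real K" using R_pos[of n] by (simp_all add: s_def RK)
  define J :: "int set" where "J = {0, 1, 2, int K - 3, int K - 2, int K - 1}"
  define I where "I = ((J \<inter> {0..<int K}) \<times> {0..<int K}) \<union> ({0..<int K} \<times> (J \<inter> {0..<int K}))"
  have cJ: "card (J \<inter> {0..<int K}) \<le> 6"
  proof -
    have "card (J \<inter> {0..<int K}) \<le> card J" by (intro card_mono) (auto simp: J_def)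
    also have "card J \<le> 6" unfolding J_def by (intro order_trans[OF card_insert_le_m1]) (auto intro!: card_insert_le_m1)
    finally show ?thesis .
  qed
  have fin: "finite I" by (auto simp: I_def)
  have "card I \<le> card (J \<inter> {0..<int K}) * K + K * card (J \<inter> {0..<int K})"
    unfolding I_def by (rule order_trans[OF card_Un_le]) (simp add: card_cartesian_product)
  also have "\<dots> \<le> 6 * K + K * 6" using cJ by (intro add_mono mult_mono) auto
  finally have cI: "card I \<le> 12 * K" by simp
  have edge: "\<lfloor>s * t\<rfloor> \<in> J" if t: "0 \<le> t" "t < real (R (Suc n))" "t < 3 * real (R n) \<or> real (R (Suc n)) - 3 * real (R n) < t" for t
  proof -
    have "0 \<le> s * t" "s * t < real K" using t s(1) by (simp_all flip: s(2))
    moreover have "s * t < 3 \<or> real K - 3 < s * t"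
      using t(3) R_pos[of n] unfolding s_def RK by (auto simp: field_simps)
    ultimately have "0 \<le> \<lfloor>s * t\<rfloor>" "\<lfloor>s * t\<rfloor> < int K" "\<lfloor>s * t\<rfloor> < 3 \<or> int K - 3 \<le> \<lfloor>s * t\<rfloor>"
      by (auto simp: floor_less_iff le_floor_iff)
    then show ?thesis unfolding J_def insert_iff empty_iff by presburger
  qed
  have "space M - deep n \<subseteq> (\<Union>v\<in>I. cell s (Suc n) v)"
  proof
    fix g assume g: "g \<in> space M - deep n"
    then have gs: "g \<in> space M" by simp
    note rg = X_range[OF gs, of "Suc n"]
    let ?v = "(\<lfloor>s * Re (X (Suc n) g)\<rfloor>, \<lfloor>s * Im (X (Suc n) g)\<rfloor>)"
    have in_range: "0 \<le> \<lfloor>s * Re (X (Suc n) g)\<rfloor>" "\<lfloor>s * Re (X (Suc n) g)\<rfloor> < int K"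
       "0 \<le> \<lfloor>s * Im (X (Suc n) g)\<rfloor>" "\<lfloor>s * Im (X (Suc n) g)\<rfloor> < int K"
      using rg s(1) by (simp_all add: floor_less_iff flip: s(2))
    have "?v \<in> I"
    proof (cases "\<lfloor>s * Re (X (Suc n) g)\<rfloor> \<in> J")
      case True
      then show ?thesis using in_range by (simp add: I_def)
    next
      case False
      then have "\<lfloor>s * Im (X (Suc n) g)\<rfloor> \<in> J"
        using g rg edge[of "Re (X (Suc n) g)"] edge[of "Im (X (Suc n) g)"]
        unfolding deep_def by auto
      then show ?thesis using in_range by (simp add: I_def)
    qed
    moreover have "g \<in> cell s (Suc n) ?v" using gs by (simp add: cell_def)
    ultimately show "g \<in> (\<Union>v\<in>I. cell s (Suc n) v)" by blast
  qed
  then have "prob (space M - deep n) \<le> prob (\<Union>v\<in>I. cell s (Suc n) v)"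
    using fin by (intro finite_measure_mono) auto
  also have "\<dots> \<le> (\<Sum>v\<in>I. prob (cell s (Suc n) v))"
    using fin by (intro finite_measure_subadditive_finite) auto
  also have "\<dots> = (\<Sum>v\<in>I. 1 / real K ^ 2)"
    by (intro sum.cong refl prob_cell[OF s]) (auto simp: I_def)
  also have "\<dots> = real (card I) / real K ^ 2" by simp
  also have "\<dots> \<le> real (12 * K) / real K ^ 2" using cI by (intro divide_right_mono) (simp_all del: of_nat_mult)
  also have "\<dots> = 12 * (real (R n) / real (R (Suc n)))"
    using K0 R_pos[of n] by (simp add: RK power2_eq_square field_simps)
  finally show ?thesis .
qed

lemma AE_eventually_deep:
  assumes "summable (\<lambda>n. real (R n) / real (R (Suc n)))"
  shows "AE g in M. \<exists>N. \<forall>n\<ge>N. g \<in> deep n"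
proof -
  have "AE g in M. \<forall>\<^sub>F n in sequentially. g \<in> space M - (space M - deep n)"
  proof (rule borel_cantelli_AE1)
    show "space M - deep n \<in> sets M" for n by measurable
    show "emeasure M (space M - deep n) < \<infinity>" for n by (simp add: less_top[symmetric])
    show "summable (\<lambda>n. measure M (space M - deep n))"
    proof (rule summable_comparison_test')
      show "summable (\<lambda>n. 12 * (real (R n) / real (R (Suc n))))" using assms by (rule summable_mult)
      show "norm (prob (space M - deep n)) \<le> 12 * (real (R n) / real (R (Suc n)))" for n
        using prob_not_deep[of n] by simp
    qed
  qed
  then show ?thesis by (rule AE_mp) (auto simp: eventually_sequentially)
qed

text \<open>A move that does not cross the boundary of the square needs no reduction modulo the lattice.\<close>

lemma deep_shift:
  assumes g: "g \<in> deep n" and z: "\<bar>Re z\<bar> \<le> 2 * real (R n)" "\<bar>Im z\<bar> \<le> 2 * real (R n)"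
  shows "X (Suc n) g + z \<in> core R n" "X (Suc n) (act z g) = X (Suc n) g + z"
proof -
  have gs: "g \<in> space M" using g by (simp add: deep_def)
  show c: "X (Suc n) g + z \<in> core R n" using g z by (auto simp: deep_def core_def)
  then show "X (Suc n) (act z g) = X (Suc n) g + z"
    using X_range[OF act_space[OF gs], of "Suc n" z] R_pos[of n]
    by (intro square_rep_unique[OF X_act[OF gs]]) (auto simp: core_def)
qed

text \<open>A point that is deep at the next level lies in a tile with indices at least 2, so not in the
  exceptional tile \<open>(1, 1)\<close>.\<close>

lemma deep_bond:
  assumes g: "g \<in> deep (Suc n)"
  obtains a b where "a < R (Suc (Suc n)) div R (Suc n)" "b < R (Suc (Suc n)) div R (Suc n)" "a \<noteq> 1"
    "X (Suc (Suc n)) g = X (Suc n) g + of_nat (R (Suc n)) * Complex (of_nat a) (of_nat b)"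
proof -
  let ?r = "real (R (Suc n))"
  define K where "K = R (Suc (Suc n)) div R (Suc n)"
  have RK: "R (Suc (Suc n)) = K * R (Suc n)" using R_dvd[of "Suc n"] by (simp add: K_def)
  have r: "?r > 0" using R_pos by simp
  have gs: "g \<in> space M" using g by (simp add: deep_def)
  obtain a b :: int where ab: "Re (X (Suc (Suc n)) g - X (Suc n) g) = of_int a * ?r"
    "Im (X (Suc (Suc n)) g - X (Suc n) g) = of_int b * ?r"
    using gaussian_latticeE[OF X_bond[OF gs]] by blast
  note X1 = X_range[OF gs, of "Suc n"] and X2 = X_range[OF gs, of "Suc (Suc n)"]
  have bound: "-1 < c \<and> c < int K" if "- ?r < of_int c * ?r" "of_int c * ?r < real K * ?r" for c :: int
  proof -
    have "(-1) * ?r < of_int c * ?r" using that by simp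
    then have "-1 < (of_int c :: real)"
      using r mult_right_less_imp_less[OF _ less_imp_le] by blast
    moreover have "(of_int c :: real) < real K"
      using that(2) r mult_right_less_imp_less[OF _ less_imp_le] by blast
    ultimately show ?thesis by linarith
  qed
  have X2': "Re (X (Suc (Suc n)) g) < real K * ?r" "Im (X (Suc (Suc n)) g) < real K * ?r"
    using X2 by (simp_all add: RK)
  have "-1 < a \<and> a < int K" "-1 < b \<and> b < int K"
    using ab X1 X2 X2' unfolding minus_complex.sel by (intro bound; linarith)+
  moreover have "3 * ?r \<le> Re (X (Suc (Suc n)) g)" using g by (simp add: deep_def)
  then have "1 * ?r < of_int a * ?r"
    using ab(1) X1 r unfolding minus_complex.sel by linarith
  then have "1 < a" using r mult_right_less_imp_less[of 1 ?r "of_int a"] by simp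
  ultimately show thesis
    using ab by (intro that[of "nat a" "nat b"]) (auto simp: complex_eq_iff K_def[symmetric] nat_less_iff algebra_simps)
qed

end

section \<open>The limit function along an orbit\<close>

lemma geometric_limit:
  fixes a :: "nat \<Rightarrow> complex"
  assumes "\<And>m. m \<ge> n \<Longrightarrow> norm (a (Suc m) - a m) \<le> (1/2) ^ m"
  shows "convergent a" and "m \<ge> n \<Longrightarrow> norm (lim a - a m) \<le> 2 * (1/2) ^ m"
proof -
  have step: "norm (a (m + j) - a m) \<le> 2 * (1/2) ^ m - 2 * (1/2) ^ (m + j)" if "m \<ge> n" for m j
  proof (induction j)
    case (Suc j)
    have "norm (a (m + Suc j) - a m) \<le> norm (a (Suc (m + j)) - a (m + j)) + norm (a (m + j) - a m)"
      using norm_triangle_ineq[of "a (Suc (m + j)) - a (m + j)" "a (m + j) - a m"] by simp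
    also have "\<dots> \<le> (1/2) ^ (m + j) + (2 * (1/2) ^ m - 2 * (1/2) ^ (m + j))"
      using Suc assms[of "m + j"] that by (intro add_mono) auto
    finally show ?case by simp
  qed simp
  have bound: "norm (a k - a m) \<le> 2 * (1/2) ^ m" if "m \<ge> n" "k \<ge> m" for k m
  proof -
    have "norm (a k - a m) \<le> 2 * (1/2) ^ m - 2 * (1/2) ^ k"
      using step[OF that(1), of "k - m"] that(2) by simp
    then show ?thesis by (smt (verit) zero_le_power divide_nonneg_nonneg)
  qed
  have "Cauchy a"
  proof (rule metric_CauchyI)
    fix e :: real assume e: "e > 0"
    obtain k where k: "(1/2::real) ^ k < e / 4"
      using real_arch_pow_inv[of "e/4" "1/2"] e by auto
    define m where "m = max k n"
    have "(1/2::real) ^ m \<le> (1/2) ^ k" by (intro power_decreasing) (auto simp: m_def)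
    then have "2 * (1/2::real) ^ m < e / 2" using k by linarith
    then have "dist (a i) (a m) < e / 2" if "i \<ge> m" for i
      using bound[of m i] that by (simp add: m_def dist_norm)
    then show "\<exists>M. \<forall>i\<ge>M. \<forall>j\<ge>M. dist (a i) (a j) < e"
      by (meson dist_triangle_half_l)
  qed
  then show conv: "convergent a" by (simp add: Cauchy_convergent_iff)
  show "norm (lim a - a m) \<le> 2 * (1/2) ^ m" if "m \<ge> n"
  proof (rule tendsto_upperbound)
    show "(\<lambda>k. norm (a k - a m)) \<longlonglongrightarrow> norm (lim a - a m)"
      using conv unfolding convergent_LIMSEQ_iff by (intro tendsto_intros)
    show "\<forall>\<^sub>F k in sequentially. norm (a k - a m) \<le> 2 * (1/2) ^ m"
      using bound[OF that] eventually_sequentially by blast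
  qed simp
qed

text \<open>Growth by a factor of 4 makes room in the exceptional tile: the disc of radius \<open>R n\<close> around the
  centre of the copy of \<open>q n\<close>, which is \<open>2 R n\<close> away from two sides, keeps a margin of \<open>R n\<close> to all sides.\<close>

locale tower_on_flow = solenoidal_flow M act R X
  for M :: "'g measure" and act R X +
  fixes q f :: "nat \<Rightarrow> complex \<Rightarrow> complex"
  assumes growth: "\<And>n. 4 * R n \<le> R (Suc n)"
    and q_dense: "\<And>p k e m. p holomorphic_on UNIV \<Longrightarrow> (e::real) > 0 \<Longrightarrow>
       \<exists>n\<ge>m. \<forall>z. norm z \<le> k \<longrightarrow> norm (q n z - p z) < e"
    and f_entire: "\<And>n. f n holomorphic_on UNIV"
    and f_tiles: "\<And>n. tiles R n (q n) (f n) (f (Suc n))"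
begin

lemmas f_step = f_tiles[unfolded tiles_def, rule_format]

definition F :: "'g \<Rightarrow> complex" where
  "F g = lim (\<lambda>n. f n (X (Suc n) g))"

lemma F_measurable [measurable]: "F \<in> borel_measurable M"
proof -
  have "(\<lambda>g. f n (X (Suc n) g)) \<in> borel_measurable M" for n
    using f_entire[of n] holomorphic_on_imp_continuous_on
    by (intro measurable_compose[OF X_measurable] borel_measurable_continuous_onI) auto
  then show ?thesis unfolding F_def by (rule borel_measurable_lim_metric)
qed

lemma R_mono: "n \<le> m \<Longrightarrow> R n \<le> R m"
proof (rule lift_Suc_mono_le[of R])
  show "R n \<le> R (Suc n)" for n using growth[of n] by linarith
qed

lemma R_ge: "n < R n"
proof (induction n)
  case 0 then show ?case using R_pos by simp
next
  case (Suc n) then show ?case using growth[of n] by linarith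
qed

lemma tower_step:
  assumes g: "\<And>n. n \<ge> N \<Longrightarrow> g \<in> deep n" and n: "n \<ge> N"
    and z: "\<bar>Re z\<bar> \<le> 2 * real (R n)" "\<bar>Im z\<bar> \<le> 2 * real (R n)"
  shows "norm (f (Suc n) (X (Suc (Suc n)) g + z) - f n (X (Suc n) g + z)) < (1/2) ^ n"
proof -
  obtain a b where ab: "a < R (Suc (Suc n)) div R (Suc n)" "b < R (Suc (Suc n)) div R (Suc n)" "a \<noteq> 1"
    "X (Suc (Suc n)) g = X (Suc n) g + of_nat (R (Suc n)) * Complex (of_nat a) (of_nat b)"
    using deep_bond[OF g[of "Suc n"]] n by auto
  show ?thesis
    using f_step[OF ab(1,2) deep_shift(1)[OF g[OF n] z]] ab(3) by (simp add: ab(4) algebra_simps)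
qed

text \<open>On the window of half-width \<open>2 R n\<close> around a deep point, the values of all later \<open>f\<^sub>m\<close> are linked by
  \<open>tower_step\<close> to those of \<open>f\<^sub>n\<close>, and the errors \<open>2\<^sup>-\<^sup>m\<close> sum to \<open>2 \<sqdot> 2\<^sup>-\<^sup>n\<close>. At level \<open>n\<close> the
  function \<open>f n\<close> lives on the square of side \<open>R (Suc n)\<close>.\<close>

lemma F_orbit_approx:
  assumes g: "\<And>n. n \<ge> N \<Longrightarrow> g \<in> deep n" and n: "n \<ge> N"
    and z: "\<bar>Re z\<bar> \<le> 2 * real (R n)" "\<bar>Im z\<bar> \<le> 2 * real (R n)"
  shows "norm (F (act z g) - f n (X (Suc n) g + z)) \<le> 2 * (1/2) ^ n"
proof -
  have zm: "\<bar>Re z\<bar> \<le> 2 * real (R m)" "\<bar>Im z\<bar> \<le> 2 * real (R m)" if "m \<ge> n" for m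
    using R_mono[OF that] z by linarith+
  have X: "X (Suc m) (act z g) = X (Suc m) g + z" if "m \<ge> n" for m
    using deep_shift(2)[OF g zm[OF that]] that n by simp
  have "norm (f (Suc m) (X (Suc (Suc m)) (act z g)) - f m (X (Suc m) (act z g))) \<le> (1/2) ^ m" if "m \<ge> n" for m
    using tower_step[OF g _ zm[OF that]] X[of m] X[of "Suc m"] that n by (simp add: less_imp_le)
  from geometric_limit(2)[of n "\<lambda>m. f m (X (Suc m) (act z g))", OF this, of n]
  show ?thesis unfolding F_def using X[of n] by simp
qed

lemma orbit_entire:
  assumes g: "\<And>n. n \<ge> N \<Longrightarrow> g \<in> deep n"
  shows "(\<lambda>z. F (act z g)) \<in> entire_functions"
proof -
  have "(\<lambda>z. F (act z g)) holomorphic_on UNIV"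
  proof (rule holomorphic_uniform_sequence)
    show "(\<lambda>z. f n (X (Suc n) g + z)) holomorphic_on UNIV" for n
    proof -
      have "(\<lambda>z. X (Suc n) g + z) holomorphic_on UNIV" by (intro holomorphic_intros)
      from holomorphic_on_compose_gen[OF this f_entire] show ?thesis by (simp add: o_def)
    qed
    fix x :: complex
    have "uniform_limit (cball x 1) (\<lambda>n z. f n (X (Suc n) g + z)) (\<lambda>z. F (act z g)) sequentially"
    proof (rule uniform_limitI)
      fix e :: real assume e: "e > 0"
      obtain k where k: "(1/2::real) ^ k < e / 2"
        using real_arch_pow_inv[of "e/2" "1/2"] e by auto
      obtain l where l: "norm x + 1 \<le> real l" using real_arch_simple by blast
      have "dist (f n (X (Suc n) g + z)) (F (act z g)) < e"
        if n: "n \<ge> max (max k l) N" and z: "z \<in> cball x 1" for n z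
      proof -
        have "norm z \<le> norm x + 1" using z norm_triangle_ineq2[of z x] by (simp add: dist_norm norm_minus_commute)
        also have "\<dots> \<le> real (R n)" using l n R_ge[of n] by linarith
        finally have "\<bar>Re z\<bar> \<le> 2 * real (R n)" "\<bar>Im z\<bar> \<le> 2 * real (R n)"
          using abs_Re_le_cmod[of z] abs_Im_le_cmod[of z] by linarith+
        then have "norm (F (act z g) - f n (X (Suc n) g + z)) \<le> 2 * (1/2) ^ n"
          using n by (intro F_orbit_approx[OF g]) auto
        also have "\<dots> \<le> 2 * (1/2) ^ k" using n by (intro mult_left_mono power_decreasing) auto
        finally show ?thesis using k by (simp add: dist_norm norm_minus_commute)
      qed
      then show "\<forall>\<^sub>F n in sequentially. \<forall>z\<in>cball x 1. dist (f n (X (Suc n) g + z)) (F (act z g)) < e"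
        unfolding eventually_sequentially by blast
    qed
    then show "\<exists>d>0. cball x d \<subseteq> UNIV \<and>
      uniform_limit (cball x d) (\<lambda>n z. f n (X (Suc n) g + z)) (\<lambda>z. F (act z g)) sequentially"
      by (intro exI[of _ 1]) auto
  qed auto
  then show ?thesis by (simp add: entire_functions_def)
qed

text \<open>Given a target \<open>p\<close>, choose a late \<open>n\<close> with \<open>q n\<close> close to \<open>p\<close>, and let \<open>z0\<close> lead from \<open>g\<close> to the centre
  \<open>c\<close> of the copy of \<open>q n\<close> in its square of side \<open>R (n + 2)\<close>. Near \<open>c\<close> the function \<open>f (n + 1)\<close> imitates
  \<open>q n\<close>. As \<open>c\<close> belongs to the core and \<open>g\<close> avoids the exceptional tile one level up, \<open>f (n + 2)\<close>
  repeats these values at the corresponding place. The move \<open>z0\<close> is shorter than the window of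
  level \<open>n + 2\<close>, on which \<open>f (n + 2)\<close> in turn approximates \<open>F\<close>.\<close>

lemma orbit_universal:
  assumes g: "\<And>n. n \<ge> N \<Longrightarrow> g \<in> deep n"
  shows "(\<lambda>z. F (act z g)) \<in> universal_entire"
  unfolding universal_entire_iff
proof (intro conjI ballI allI impI)
  show "(\<lambda>z. F (act z g)) \<in> entire_functions" using orbit_entire[OF g] .
  fix p K and e :: real
  assume p: "p \<in> entire_functions" and K: "compact (K :: complex set)" and e: "e > 0"
  obtain r where r: "\<And>z. z \<in> K \<Longrightarrow> norm z \<le> r"
    using compact_imp_bounded[OF K] unfolding bounded_iff by blast
  obtain k where k: "(1/2::real) ^ k < e / 4"
    using real_arch_pow_inv[of "e/4" "1/2"] e by auto
  obtain l where l: "r \<le> real l" using real_arch_simple by blast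
  obtain n where n: "n \<ge> max (max k l) N" "\<And>z. norm z \<le> r \<Longrightarrow> norm (q n z - p z) < e/2"
    using q_dense[of p "e/2" "max (max k l) N" r] p e unfolding entire_functions_def by auto
  have nN: "n \<ge> N" using n(1) by simp
  define c where "c = of_nat (R (Suc n)) * Complex 1 1 + of_nat (R n) * Complex 2 2"
  define z0 where "z0 = c - X (Suc (Suc n)) g"
  have gs: "g \<in> space M" using g[OF nN] by (simp add: deep_def)
  have gr: "4 * real (R n) \<le> real (R (Suc n))" "4 * real (R (Suc n)) \<le> real (R (Suc (Suc n)))"
    using growth[of n] growth[of "Suc n"] by linarith+
  have k1: "1 < R (Suc (Suc n)) div R (Suc n)"
    using growth[of "Suc n"] R_pos[of "Suc n"] by (simp add: less_eq_div_iff_mult_less_eq Suc_le_eq[symmetric])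
  obtain a b where ab: "a < R (Suc (Suc (Suc n))) div R (Suc (Suc n))" "b < R (Suc (Suc (Suc n))) div R (Suc (Suc n))" "a \<noteq> 1"
    "X (Suc (Suc (Suc n))) g = X (Suc (Suc n)) g + of_nat (R (Suc (Suc n))) * Complex (of_nat a) (of_nat b)"
    using deep_bond[OF g[of "Suc (Suc n)"]] nN by auto
  have "dist (p w) (F (act (w + z0) g)) < e" if w: "w \<in> K" for w
  proof -
    have wr: "norm w \<le> r" using r[OF w] .
    have "norm w \<le> real (R n)" using wr l n(1) R_ge[of n] by linarith
    then have wR: "\<bar>Re w\<bar> \<le> real (R n)" "\<bar>Im w\<bar> \<le> real (R n)"
      using abs_Re_le_cmod[of w] abs_Im_le_cmod[of w] by linarith+
    have c1: "w + of_nat (R n) * Complex 2 2 \<in> core R n"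
      using wR gr by (auto simp: core_def)
    have s1: "norm (f (Suc n) (c + w) - q n w) < (1/2) ^ n"
      using f_step[OF k1 k1 c1] by (simp add: c_def algebra_simps)
    have c2: "c + w \<in> core R (Suc n)"
      using wR gr by (auto simp: core_def c_def)
    have "norm (f (Suc (Suc n)) (c + w + of_nat (R (Suc (Suc n))) * Complex (of_nat a) (of_nat b)) - f (Suc n) (c + w)) < (1/2) ^ Suc n"
      using f_step[OF ab(1,2) c2] ab(3) by simp
    moreover have "c + w + of_nat (R (Suc (Suc n))) * Complex (of_nat a) (of_nat b) = X (Suc (Suc (Suc n))) g + (w + z0)"
      by (simp add: ab(4) z0_def)
    ultimately have s2: "norm (f (Suc (Suc n)) (X (Suc (Suc (Suc n))) g + (w + z0)) - f (Suc n) (c + w)) < (1/2) ^ Suc n"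
      by simp
    have "\<bar>Re (w + z0)\<bar> \<le> 2 * real (R (Suc (Suc n)))" "\<bar>Im (w + z0)\<bar> \<le> 2 * real (R (Suc (Suc n)))"
      using wR gr X_range[OF gs, of "Suc (Suc n)"] by (auto simp: z0_def c_def)
    then have s3: "norm (F (act (w + z0) g) - f (Suc (Suc n)) (X (Suc (Suc (Suc n))) g + (w + z0))) \<le> 2 * (1/2) ^ (Suc (Suc n))"
      using nN by (intro F_orbit_approx[OF g]) auto
    have "dist (q n w) (F (act (w + z0) g)) < 2 * (1/2) ^ n"
      using s1 s2 s3 norm_triangle_ineq[of "F (act (w + z0) g) - f (Suc (Suc n)) (X (Suc (Suc (Suc n))) g + (w + z0))"
          "f (Suc (Suc n)) (X (Suc (Suc (Suc n))) g + (w + z0)) - f (Suc n) (c + w)"]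
        norm_triangle_ineq[of "F (act (w + z0) g) - f (Suc n) (c + w)" "f (Suc n) (c + w) - q n w"]
      by (simp add: dist_norm norm_minus_commute)
    also have "\<dots> \<le> 2 * (1/2) ^ k" using n(1) by (intro mult_left_mono power_decreasing) auto
    also have "\<dots> < e / 2" using k by simp
    finally have "dist (q n w) (F (act (w + z0) g)) < e/2" .
    moreover have "dist (q n w) (p w) < e/2" using n(2)[OF wr] by (simp add: dist_norm)
    ultimately show ?thesis using dist_triangle_half_r by blast
  qed
  then show "\<exists>z. \<forall>w\<in>K. dist (p w) (F (act (w + z) g)) < e" by blast
qed

end

section \<open>The push-forward measure\<close>

context solenoidal_flow
begin

text \<open>On the set \<open>D\<close> of eventually deep points the orbit map is defined and equivariant, so it carries
  invariance and ergodicity of \<open>M\<close> to the image measure.\<close>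

theorem universal_orbit_function:
  assumes growth: "\<And>n. 4 * R n \<le> R (Suc n)"
    and summable: "summable (\<lambda>n. real (R n) / real (R (Suc n)))"
  shows "\<exists>F \<in> borel_measurable M.
           (AE g in M. (\<lambda>z. F (act z g)) \<in> universal_entire) \<and>
           (\<exists>\<mu>. is_pushforward_ae M entire_borel (\<lambda>g z. F (act z g)) \<mu> \<and>
                ergodic_measure \<mu> \<and> (AE f in \<mu>. f \<in> universal_entire))"
proof -
  obtain q :: "nat \<Rightarrow> complex \<Rightarrow> complex" where q: "\<And>n. q n holomorphic_on UNIV"
    "\<And>p k e m. p holomorphic_on UNIV \<Longrightarrow> (e::real) > 0 \<Longrightarrow> \<exists>n\<ge>m. \<forall>z. norm z \<le> k \<longrightarrow> norm (q n z - p z) < e"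
    using entire_dense_sequence by blast
  obtain f :: "nat \<Rightarrow> complex \<Rightarrow> complex"
    where f: "\<And>n. f n holomorphic_on UNIV" "\<And>n. tiles R n (q n) (f n) (f (Suc n))"
    using entire_tower[of R q, OF R_pos R_dvd q(1)] by metis
  interpret tower_on_flow M act R X q f
    using growth q(2) f by unfold_locales auto
  define D where "D = {g \<in> space M. \<exists>N. \<forall>n\<ge>N. g \<in> deep n}"
  have D_sets [measurable]: "D \<in> sets M" unfolding D_def by measurable
  have AE_D: "AE g in M. g \<in> D"
    using AE_eventually_deep[OF summable] by (rule AE_mp) (auto simp: D_def)
  have D_univ: "(\<lambda>z. F (act z g)) \<in> universal_entire" if "g \<in> D" for g
    using that orbit_universal unfolding D_def by blast
  \<comment> \<open>Off \<open>D\<close> a constant keeps the values of \<open>h\<close> inside the space of entire functions.\<close>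
  define h where "h g = (if g \<in> D then (\<lambda>z. F (act z g)) else (\<lambda>_. 0))" for g
  have h_range: "h g \<in> entire_functions" for g
    using D_univ[of g] by (auto simp: h_def universal_entire_def) (simp add: entire_functions_def)
  have h_meas [measurable]: "h \<in> measurable M entire_borel"
  proof (rule measurable_into_entire_borel[OF h_range])
    fix z
    have "(\<lambda>g. F (act z g)) \<in> borel_measurable M"
      by (rule measurable_compose[OF act_measurable F_measurable])
    then have "(\<lambda>g. if g \<in> D then F (act z g) else 0) \<in> borel_measurable M" by measurable
    moreover have "(\<lambda>g. h g z) = (\<lambda>g. if g \<in> D then F (act z g) else 0)" by (auto simp: h_def)
    ultimately show "(\<lambda>g. h g z) \<in> borel_measurable M" by simp
  qed
  have h_AE: "AE g in M. h g = (\<lambda>z. F (act z g))"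
    using AE_D by (rule AE_mp) (simp add: h_def)
  have h_act: "AE g in M. h (act z g) = translate z (h g)" for z
  proof -
    have "AE g in distr M M (act z). h g = (\<lambda>z. F (act z g))" unfolding act_preserving by (rule h_AE)
    then have "AE g in M. h (act z g) = (\<lambda>w. F (act w (act z g)))"
      by (rule AE_distrD[OF act_measurable])
    with h_AE AE_space show ?thesis
      by eventually_elim (simp add: translate_def act_act)
  qed
  define \<mu> where "\<mu> = distr M entire_borel h"
  have sets_\<mu> [measurable_cong]: "sets \<mu> = sets entire_borel" by (simp add: \<mu>_def)
  have space_\<mu>: "space \<mu> = entire_functions" by (simp add: \<mu>_def)
  have univ: "AE f in \<mu>. f \<in> universal_entire"
  proof -
    have "{f \<in> space entire_borel. f \<in> universal_entire} = universal_entire"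
      by (auto simp: universal_entire_def)
    moreover have "AE g in M. h g \<in> universal_entire"
      using AE_D by (rule AE_mp) (simp add: h_def D_univ)
    ultimately show ?thesis
      unfolding \<mu>_def by (subst AE_distr_iff) (simp_all add: universal_entire_sets)
  qed
  have inv: "distr \<mu> \<mu> (translate z) = \<mu>" for z
  proof -
    have "distr \<mu> \<mu> (translate z) = distr \<mu> entire_borel (translate z)"
      by (rule distr_cong) (simp_all add: sets_\<mu>)
    also have "\<dots> = distr M entire_borel (translate z \<circ> h)"
      unfolding \<mu>_def by (rule distr_distr[OF translate_measurable h_meas])
    also have "\<dots> = distr M entire_borel (h \<circ> act z)"
      using h_act[of z] translate_measurable
      by (intro distr_cong_AE) (auto elim!: eventually_mono)
    also have "\<dots> = distr (distr M M (act z)) entire_borel h"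
      by (rule distr_distr[symmetric, OF h_meas act_measurable])
    also have "\<dots> = \<mu>" by (simp add: act_preserving \<mu>_def)
    finally show ?thesis .
  qed
  have erg: "emeasure \<mu> A = 0 \<or> emeasure \<mu> A = 1"
    if A: "A \<in> sets \<mu>" and Ainv: "\<And>z. emeasure \<mu> (sym_diff (translate z -` A \<inter> space \<mu>) A) = 0" for A
  proof -
    define B where "B = h -` A \<inter> space M"
    have A': "A \<in> sets entire_borel" using A by (simp add: sets_\<mu>)
    have B: "B \<in> sets M" unfolding B_def using h_meas A' by (rule measurable_sets)
    have "AE g in M. act z g \<in> B \<longleftrightarrow> g \<in> B" for z
    proof -
      have "translate z -` A \<inter> space \<mu> \<in> sets \<mu>"
        using measurable_sets[OF translate_measurable A', of z] by (simp add: sets_\<mu> space_\<mu>)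
      then have "sym_diff (translate z -` A \<inter> space \<mu>) A \<in> null_sets \<mu>"
        using A Ainv[of z] by (intro null_setsI) auto
      then have "AE f in \<mu>. f \<notin> sym_diff (translate z -` A \<inter> space \<mu>) A" by (rule AE_not_in)
      then have "AE g in M. h g \<notin> sym_diff (translate z -` A \<inter> space \<mu>) A"
        unfolding \<mu>_def by (rule AE_distrD[OF h_meas])
      with h_act[of z] AE_space show ?thesis
        by eventually_elim (auto simp: B_def space_\<mu> h_range act_space)
    qed
    from invariant_prob_0_or_1[OF B this] have "prob B = 0 \<or> prob B = 1" .
    moreover have "emeasure \<mu> A = ennreal (prob B)"
      unfolding \<mu>_def B_def using emeasure_distr[OF h_meas A'] emeasure_eq_measure by simp
    ultimately show ?thesis by auto
  qed
  have "prob_space \<mu>" unfolding \<mu>_def by (rule prob_space_distr[OF h_meas])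
  moreover have "translate z \<in> measurable \<mu> \<mu>" for z
    using translate_measurable[of z] measurable_cong_sets[OF sets_\<mu> sets_\<mu>] by simp
  ultimately have "ergodic_measure \<mu>"
    unfolding ergodic_measure_def using sets_\<mu> inv erg by blast
  moreover have "is_pushforward_ae M entire_borel (\<lambda>g z. F (act z g)) \<mu>"
    unfolding is_pushforward_ae_def using h_meas h_AE \<mu>_def by blast
  moreover have "AE g in M. (\<lambda>z. F (act z g)) \<in> universal_entire"
    using AE_D by (rule AE_mp) (simp add: D_univ)
  ultimately show ?thesis using univ F_measurable by blast
qed

end

section \<open>The solenoid\<close>

lemma scaled_lattice_eq: "scaled_lattice r n = gaussian_lattice (R_prod r n)"
  by (simp add: scaled_lattice_def gaussian_lattice_def)

lemma R_prod_Suc: "R_prod r (Suc n) = R_prod r n * r (Suc n)"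
  by (simp add: R_prod_def prod.nat_ivl_Suc')

lemma R_prod_dvd: "m \<le> n \<Longrightarrow> R_prod r m dvd R_prod r n"
  by (induction rule: dec_induct) (auto simp: R_prod_Suc)

lemma mem_torus_proj: "w \<in> torus_proj r n z \<longleftrightarrow> w - z \<in> scaled_lattice r n"
  unfolding torus_proj_def r_coset_def plane_group_def
  by (auto intro!: bexI[of _ "w - z"])

lemma torus_proj_eq_iff: "torus_proj r n w = torus_proj r n z \<longleftrightarrow> w - z \<in> scaled_lattice r n"
proof
  assume "torus_proj r n w = torus_proj r n z"
  moreover have "w \<in> torus_proj r n w" by (simp add: mem_torus_proj scaled_lattice_eq)
  ultimately show "w - z \<in> scaled_lattice r n" by (simp add: mem_torus_proj)
next
  assume wz: "w - z \<in> scaled_lattice r n"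
  show "torus_proj r n w = torus_proj r n z"
  proof (rule Set.set_eqI)
    fix x
    have "x - w \<in> scaled_lattice r n \<longleftrightarrow> x - z \<in> scaled_lattice r n"
      using gaussian_lattice_add[of "x - w" _ "w - z"] gaussian_lattice_diff[of "x - z" _ "w - z"] wz
      unfolding scaled_lattice_eq by auto
    then show "x \<in> torus_proj r n w \<longleftrightarrow> x \<in> torus_proj r n z" by (simp add: mem_torus_proj)
  qed
qed

lemma carrier_torus: "carrier (torus r n) = range (torus_proj r n)"
  unfolding torus_def FactGroup_def RCOSETS_def torus_proj_def by (auto simp: plane_group_def)

lemma torus_mult: "torus_proj r n w \<otimes>\<^bsub>torus r n\<^esub> torus_proj r n z = torus_proj r n (w + z)"
proof -
  have "torus_proj r n w \<otimes>\<^bsub>torus r n\<^esub> torus_proj r n z = {x + y | x y. x \<in> torus_proj r n w \<and> y \<in> torus_proj r n z}"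
    unfolding torus_def FactGroup_def set_mult_def by (auto simp: plane_group_def)
  also have "\<dots> = torus_proj r n (w + z)"
  proof (intro equalityI subsetI)
    fix u assume "u \<in> {x + y | x y. x \<in> torus_proj r n w \<and> y \<in> torus_proj r n z}"
    then obtain x y where "u = x + y" "x - w \<in> scaled_lattice r n" "y - z \<in> scaled_lattice r n"
      by (auto simp: mem_torus_proj)
    then show "u \<in> torus_proj r n (w + z)"
      using gaussian_lattice_add[of "x - w" _ "y - z"]
      by (simp add: mem_torus_proj scaled_lattice_eq algebra_simps)
  next
    fix u assume "u \<in> torus_proj r n (w + z)"
    then have "u - z \<in> torus_proj r n w" "z \<in> torus_proj r n z"
      by (simp_all add: mem_torus_proj scaled_lattice_eq algebra_simps)
    then show "u \<in> {x + y | x y. x \<in> torus_proj r n w \<and> y \<in> torus_proj r n z}"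
      by (metis (mono_tags, lifting) diff_add_cancel mem_Collect_eq)
  qed
  finally show ?thesis .
qed

lemma torus_bond_proj: "torus_bond r n (torus_proj r (Suc n) z) = torus_proj r n z"
proof (rule Set.set_eqI)
  fix u
  have "u \<in> torus_bond r n (torus_proj r (Suc n) z) \<longleftrightarrow>
      (\<exists>x y. u = x + y \<and> x \<in> scaled_lattice r n \<and> y - z \<in> scaled_lattice r (Suc n))"
    unfolding torus_bond_def set_mult_def mem_torus_proj[symmetric] by (auto simp: plane_group_def)
  also have "\<dots> \<longleftrightarrow> u - z \<in> scaled_lattice r n"
  proof
    assume "\<exists>x y. u = x + y \<and> x \<in> scaled_lattice r n \<and> y - z \<in> scaled_lattice r (Suc n)"
    then obtain x y where xy: "u = x + y" "x \<in> scaled_lattice r n" "y - z \<in> scaled_lattice r (Suc n)" by blast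
    have "y - z \<in> scaled_lattice r n"
      using xy(3) gaussian_lattice_dvd R_prod_dvd[of n "Suc n" r] unfolding scaled_lattice_eq by auto
    then show "u - z \<in> scaled_lattice r n"
      using xy gaussian_lattice_add[of x _ "y - z"] unfolding scaled_lattice_eq by (simp add: algebra_simps)
  next
    assume "u - z \<in> scaled_lattice r n"
    then show "\<exists>x y. u = x + y \<and> x \<in> scaled_lattice r n \<and> y - z \<in> scaled_lattice r (Suc n)"
      by (intro exI[of _ "u - z"] exI[of _ z]) (simp add: scaled_lattice_eq)
  qed
  finally show "u \<in> torus_bond r n (torus_proj r (Suc n) z) \<longleftrightarrow> u \<in> torus_proj r n z"
    by (simp add: mem_torus_proj)
qed

lemma topspace_torus: "topspace (torus_topology r n) = range (torus_proj r n)"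
proof -
  have "openin (torus_topology r n) (range (torus_proj r n))"
    unfolding openin_torus_topology carrier_torus by (simp add: vimage_def)
  moreover have "topspace (torus_topology r n) \<subseteq> range (torus_proj r n)"
    using openin_topspace[of "torus_topology r n"] unfolding openin_torus_topology carrier_torus by blast
  ultimately show ?thesis using openin_subset by blast
qed

lemma mem_solenoid:
  "g \<in> carrier (solenoid r) \<longleftrightarrow> g \<in> (\<Pi>\<^sub>E n\<in>{1..}. range (torus_proj r n)) \<and>
     (\<forall>n\<ge>1. torus_bond r n (g (Suc n)) = g n)"
  by (simp add: solenoid_def product_group_def carrier_torus)

lemma solenoid_mult: "n \<ge> 1 \<Longrightarrow> (g \<otimes>\<^bsub>solenoid r\<^esub> h) n = g n \<otimes>\<^bsub>torus r n\<^esub> h n"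
  by (simp add: solenoid_def product_group_def)

lemma solenoid_mult_extensional: "g \<otimes>\<^bsub>solenoid r\<^esub> h \<in> extensional {1..}"
  by (simp add: solenoid_def product_group_def)

lemma solenoid_coord:
  assumes "g \<in> carrier (solenoid r)" "n \<ge> 1" obtains x where "g n = torus_proj r n x"
proof -
  have "g n \<in> range (torus_proj r n)" using assms unfolding mem_solenoid by (auto dest: PiE_mem)
  then show thesis using that by blast
qed

lemma topspace_solenoid: "topspace (solenoid_topology r) = carrier (solenoid r)"
  unfolding solenoid_topology_def topspace_subtopology topspace_product_topology topspace_torus
  by (simp add: mem_solenoid Int_absorb1 subset_eq flip: Int_def)

lemma space_borel_of_topology: "space (borel_of_topology T) = topspace T"
  unfolding borel_of_topology_def by (subst space_measure_of) (auto dest: openin_subset)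

lemma sets_borel_of_topology: "sets (borel_of_topology T) = sigma_sets (topspace T) {U. openin T U}"
  unfolding borel_of_topology_def by (subst sets_measure_of) (auto dest: openin_subset)

definition solenoid_act :: "(nat \<Rightarrow> nat) \<Rightarrow> complex \<Rightarrow> (nat \<Rightarrow> complex set) \<Rightarrow> (nat \<Rightarrow> complex set)" where
  "solenoid_act r z g = g \<otimes>\<^bsub>solenoid r\<^esub> solenoid_diag r z"

text \<open>The half-open square contains exactly one point of each coset of the lattice of scale
  \<open>R_prod r n > 0\<close>, so the choice is only formal.\<close>

definition square_rep :: "(nat \<Rightarrow> nat) \<Rightarrow> nat \<Rightarrow> (nat \<Rightarrow> complex set) \<Rightarrow> complex" where
  "square_rep r n g = (SOME w. w \<in> g n \<and> 0 \<le> Re w \<and> Re w < real (R_prod r n) \<and> 0 \<le> Im w \<and> Im w < real (R_prod r n))"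

lemma solenoid_act_coord:
  "n \<ge> 1 \<Longrightarrow> g n = torus_proj r n x \<Longrightarrow> solenoid_act r z g n = torus_proj r n (x + z)"
  by (simp add: solenoid_act_def solenoid_mult solenoid_diag_def torus_mult)

lemma solenoid_act_carrier:
  assumes g: "g \<in> carrier (solenoid r)" shows "solenoid_act r z g \<in> carrier (solenoid r)"
  unfolding mem_solenoid
proof (intro conjI allI impI)
  show "solenoid_act r z g \<in> (\<Pi>\<^sub>E n\<in>{1..}. range (torus_proj r n))"
  proof (rule PiE_I)
    fix n :: nat assume "n \<in> {1..}"
    then have n: "n \<ge> 1" by simp
    obtain x where "g n = torus_proj r n x" using solenoid_coord[OF g n] .
    then show "solenoid_act r z g n \<in> range (torus_proj r n)" using solenoid_act_coord[where g = g, OF n] by simp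
  next
    fix n :: nat assume "n \<notin> {1..}"
    then show "solenoid_act r z g n = undefined"
      using solenoid_mult_extensional unfolding solenoid_act_def by (rule extensional_arb[rotated])
  qed
  fix n :: nat assume n: "n \<ge> 1"
  obtain x where x: "g (Suc n) = torus_proj r (Suc n) x" using solenoid_coord[OF g, of "Suc n"] by auto
  then have "g n = torus_proj r n x" using g n unfolding mem_solenoid by (metis torus_bond_proj)
  then show "torus_bond r n (solenoid_act r z g (Suc n)) = solenoid_act r z g n"
    using solenoid_act_coord[where g = g, OF n] solenoid_act_coord[where g = g, OF _ x] by (simp add: torus_bond_proj)
qed

lemma solenoid_eqI:
  assumes "g \<in> extensional {1..}" "h \<in> extensional {1..}" "\<And>n. n \<ge> 1 \<Longrightarrow> g n = h n"
  shows "g = h"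
  by (rule extensionalityI[OF assms(1,2)]) (use assms(3) in simp)

lemma solenoid_extensional: "g \<in> carrier (solenoid r) \<Longrightarrow> g \<in> extensional {1..}"
  unfolding mem_solenoid by (auto simp: PiE_def)

lemma solenoid_act_act:
  assumes g: "g \<in> carrier (solenoid r)"
  shows "solenoid_act r w (solenoid_act r z g) = solenoid_act r (w + z) g"
proof (rule solenoid_eqI)
  fix n :: nat assume n: "n \<ge> 1"
  obtain x where x: "g n = torus_proj r n x" using solenoid_coord[OF g n] .
  show "solenoid_act r w (solenoid_act r z g) n = solenoid_act r (w + z) g n"
    using solenoid_act_coord[where g = "solenoid_act r z g" and r=r and n=n, OF n solenoid_act_coord[where g = g, OF n x]] solenoid_act_coord[where g = g, OF n x]
    by (simp add: algebra_simps)
qed (unfold solenoid_act_def, (rule solenoid_mult_extensional)+)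

lemma continuous_map_solenoid_coord:
  assumes "n \<ge> 1" shows "continuous_map (solenoid_topology r) (torus_topology r n) (\<lambda>g. g n)"
  unfolding solenoid_topology_def
  by (intro continuous_map_from_subtopology continuous_map_product_projection) (use assms in simp)

text \<open>The saturation of an open subset of the plane under the lattice is a union of translates.\<close>

lemma openin_solenoid_meets:
  assumes n: "n \<ge> 1" and W: "open W"
  shows "openin (solenoid_topology r) {g \<in> carrier (solenoid r). g n \<inter> W \<noteq> {}}"
proof -
  have "torus_proj r n -` {C \<in> range (torus_proj r n). C \<inter> W \<noteq> {}} = (\<Union>c\<in>scaled_lattice r n. (\<lambda>w. w - c) ` W)"
  proof (intro equalityI subsetI)
    fix z assume "z \<in> torus_proj r n -` {C \<in> range (torus_proj r n). C \<inter> W \<noteq> {}}"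
    then obtain w where "w \<in> W" "w - z \<in> scaled_lattice r n" by (auto simp: mem_torus_proj)
    then show "z \<in> (\<Union>c\<in>scaled_lattice r n. (\<lambda>w. w - c) ` W)"
      by (intro UN_I[of "w - z"] image_eqI[of _ _ w]) auto
  next
    fix z assume "z \<in> (\<Union>c\<in>scaled_lattice r n. (\<lambda>w. w - c) ` W)"
    then obtain c w where "c \<in> scaled_lattice r n" "w \<in> W" "z = w - c" by blast
    then have "w \<in> torus_proj r n z" "w \<in> W" by (simp_all add: mem_torus_proj)
    then show "z \<in> torus_proj r n -` {C \<in> range (torus_proj r n). C \<inter> W \<noteq> {}}" by auto
  qed
  moreover have "open (\<Union>c\<in>scaled_lattice r n. (\<lambda>w. w - c) ` W)"
    using open_translation_subtract[OF W] by blast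
  ultimately have "openin (torus_topology r n) {C \<in> range (torus_proj r n). C \<inter> W \<noteq> {}}"
    unfolding openin_torus_topology carrier_torus by auto
  from openin_continuous_map_preimage[OF continuous_map_solenoid_coord[OF n] this]
  have "openin (solenoid_topology r) {g \<in> carrier (solenoid r). g n \<in> range (torus_proj r n) \<and> g n \<inter> W \<noteq> {}}"
    by (simp add: topspace_solenoid)
  moreover have "g n \<in> range (torus_proj r n)" if "g \<in> carrier (solenoid r)" for g
    by (rule solenoid_coord[OF that n]) simp
  ultimately show ?thesis by (simp cong: conj_cong)
qed

lemma continuous_map_solenoid_act:
  "continuous_map (solenoid_topology r) (solenoid_topology r) (solenoid_act r z)"
proof -
  have tr: "continuous_map (torus_topology r n) (torus_topology r n) (\<lambda>C. C \<otimes>\<^bsub>torus r n\<^esub> torus_proj r n z)" for n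
    unfolding continuous_map_def topspace_torus
  proof (intro conjI allI impI)
    show "(\<lambda>C. C \<otimes>\<^bsub>torus r n\<^esub> torus_proj r n z) \<in> range (torus_proj r n) \<rightarrow> range (torus_proj r n)"
      by (auto simp: torus_mult)
    fix U assume "openin (torus_topology r n) U"
    then have U: "open (torus_proj r n -` U)" unfolding openin_torus_topology by simp
    have "torus_proj r n -` {C \<in> range (torus_proj r n). C \<otimes>\<^bsub>torus r n\<^esub> torus_proj r n z \<in> U} = (\<lambda>w. w - z) ` (torus_proj r n -` U)"
      by (auto simp: torus_mult intro!: image_eqI[of _ _ "_ + z"])
    then show "openin (torus_topology r n) {C \<in> range (torus_proj r n). C \<otimes>\<^bsub>torus r n\<^esub> torus_proj r n z \<in> U}"
      unfolding openin_torus_topology carrier_torus using open_translation_subtract[OF U, of z] by auto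
  qed
  have "continuous_map (solenoid_topology r) (torus_topology r n) (\<lambda>g. solenoid_act r z g n)" if n: "n \<ge> 1" for n
    using continuous_map_compose[OF continuous_map_solenoid_coord[OF n] tr] n
    by (simp add: o_def solenoid_act_def solenoid_mult solenoid_diag_def)
  then have "continuous_map (solenoid_topology r) (product_topology (torus_topology r) {1..}) (solenoid_act r z)"
    unfolding continuous_map_componentwise
    using solenoid_mult_extensional unfolding solenoid_act_def by auto
  then show ?thesis
    unfolding solenoid_topology_def[of r] continuous_map_in_subtopology
    using solenoid_act_carrier by (auto simp: topspace_solenoid[unfolded solenoid_topology_def])
qed

section \<open>The solenoid as a flow with square coordinates\<close>

locale solenoid_haar =
  fixes r :: "nat \<Rightarrow> nat" and \<rho> :: "(nat \<Rightarrow> complex set) measure"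
  assumes r_pos: "\<And>n. n \<ge> 1 \<Longrightarrow> r n > 0"
    and haar: "haar_probability (solenoid r) (solenoid_topology r) \<rho>"
begin

lemma R_prod_pos: "R_prod r n > 0"
  unfolding R_prod_def using r_pos by (intro prod_pos) auto

lemma prob_space_haar: "prob_space \<rho>"
  using haar by (simp add: haar_probability_def)

lemma sets_haar: "sets \<rho> = sigma_sets (carrier (solenoid r)) {U. openin (solenoid_topology r) U}"
  using haar by (simp add: haar_probability_def sets_borel_of_topology topspace_solenoid)

lemma space_haar: "space \<rho> = carrier (solenoid r)"
  using haar sets_eq_imp_space_eq[of \<rho> "borel_of_topology (solenoid_topology r)"]
  by (simp add: haar_probability_def space_borel_of_topology topspace_solenoid)

lemma openin_sets: "openin (solenoid_topology r) U \<Longrightarrow> U \<in> sets \<rho>"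
  unfolding sets_haar by (rule sigma_sets.Basic) simp

lemma act_measurable: "solenoid_act r z \<in> measurable \<rho> \<rho>"
proof (rule measurable_sigma_sets[OF sets_haar])
  show "{U. openin (solenoid_topology r) U} \<subseteq> Pow (carrier (solenoid r))"
    using openin_subset topspace_solenoid by blast
  show "solenoid_act r z \<in> space \<rho> \<rightarrow> carrier (solenoid r)"
    using solenoid_act_carrier by (auto simp: space_haar)
  fix U assume "U \<in> {U. openin (solenoid_topology r) U}"
  then have "openin (solenoid_topology r) {g \<in> carrier (solenoid r). solenoid_act r z g \<in> U}"
    using openin_continuous_map_preimage[OF continuous_map_solenoid_act[of r z]] by (simp add: topspace_solenoid)
  moreover have "solenoid_act r z -` U \<inter> space \<rho> = {g \<in> carrier (solenoid r). solenoid_act r z g \<in> U}"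
    by (auto simp: space_haar)
  ultimately show "solenoid_act r z -` U \<inter> space \<rho> \<in> sets \<rho>" using openin_sets by simp
qed

text \<open>The preimage of \<open>A\<close> under the shift by \<open>z\<close> is the left translate of \<open>A\<close> by the diagonal element of \<open>-z\<close>,
  so invariance of the Haar measure applies.\<close>

lemma act_preserving: "distr \<rho> \<rho> (solenoid_act r z) = \<rho>"
proof (rule measure_eqI)
  fix A assume "A \<in> sets (distr \<rho> \<rho> (solenoid_act r z))"
  then have A: "A \<in> sets \<rho>" by simp
  have diag: "solenoid_diag r w \<in> carrier (solenoid r)" for w
    unfolding mem_solenoid solenoid_diag_def by (auto simp: torus_bond_proj)
  have diag_mult: "solenoid_diag r w \<otimes>\<^bsub>solenoid r\<^esub> g = solenoid_act r w g" if g: "g \<in> carrier (solenoid r)" for g w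
  proof (rule solenoid_eqI)
    fix n :: nat assume n: "n \<ge> 1"
    obtain x where x: "g n = torus_proj r n x" using solenoid_coord[OF g n] .
    show "(solenoid_diag r w \<otimes>\<^bsub>solenoid r\<^esub> g) n = solenoid_act r w g n"
      using n by (simp add: solenoid_act_coord[where g = g, OF n x] solenoid_mult solenoid_diag_def x torus_mult add.commute)
  qed (unfold solenoid_act_def, (rule solenoid_mult_extensional)+)
  have zero: "solenoid_act r 0 g = g" if g: "g \<in> carrier (solenoid r)" for g
  proof (rule solenoid_eqI)
    fix n :: nat assume n: "n \<ge> 1"
    obtain x where x: "g n = torus_proj r n x" using solenoid_coord[OF g n] .
    show "solenoid_act r 0 g n = g n" using solenoid_act_coord[where g = g, OF n x] x by simp
  qed (rule solenoid_extensional[OF solenoid_act_carrier[OF g]], rule solenoid_extensional[OF g])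
  have sub: "A \<subseteq> carrier (solenoid r)" using sets.sets_into_space[OF A] by (simp add: space_haar)
  have "solenoid_act r z -` A \<inter> space \<rho> = solenoid_diag r (- z) <#\<^bsub>solenoid r\<^esub> A"
  proof (intro equalityI subsetI)
    fix g assume "g \<in> solenoid_act r z -` A \<inter> space \<rho>"
    then have g: "solenoid_act r z g \<in> A" "g \<in> carrier (solenoid r)" by (auto simp: space_haar)
    have "g = solenoid_diag r (- z) \<otimes>\<^bsub>solenoid r\<^esub> solenoid_act r z g"
      using diag_mult[OF solenoid_act_carrier[OF g(2)]] solenoid_act_act[OF g(2), of "-z" z] zero[OF g(2)] by simp
    then show "g \<in> solenoid_diag r (- z) <#\<^bsub>solenoid r\<^esub> A" using g(1) unfolding l_coset_def by blast
  next
    fix g assume "g \<in> solenoid_diag r (- z) <#\<^bsub>solenoid r\<^esub> A"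
    then obtain a where a: "a \<in> A" "g = solenoid_diag r (- z) \<otimes>\<^bsub>solenoid r\<^esub> a" unfolding l_coset_def by blast
    then have ac: "a \<in> carrier (solenoid r)" using sub by blast
    have "g = solenoid_act r (- z) a" using a diag_mult[OF ac] by simp
    then show "g \<in> solenoid_act r z -` A \<inter> space \<rho>"
      using solenoid_act_act[OF ac, of z "-z"] zero[OF ac] a(1) solenoid_act_carrier[OF ac]
      by (simp add: space_haar)
  qed
  then have "emeasure (distr \<rho> \<rho> (solenoid_act r z)) A = emeasure \<rho> (solenoid_diag r (- z) <#\<^bsub>solenoid r\<^esub> A)"
    by (simp add: emeasure_distr[OF act_measurable A])
  also have "\<dots> = emeasure \<rho> A" using haar A diag by (simp add: haar_probability_def)
  finally show "emeasure (distr \<rho> \<rho> (solenoid_act r z)) A = emeasure \<rho> A" .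
qed simp

lemma square_rep:
  assumes g: "g \<in> carrier (solenoid r)" and n: "n \<ge> 1"
  shows "square_rep r n g \<in> g n" "0 \<le> Re (square_rep r n g)" "Re (square_rep r n g) < real (R_prod r n)"
    "0 \<le> Im (square_rep r n g)" "Im (square_rep r n g) < real (R_prod r n)"
proof -
  obtain x where x: "g n = torus_proj r n x" using solenoid_coord[OF g n] .
  have "\<exists>w. w \<in> g n \<and> 0 \<le> Re w \<and> Re w < real (R_prod r n) \<and> 0 \<le> Im w \<and> Im w < real (R_prod r n)"
    using square_rep_exists[OF R_prod_pos, of x n] unfolding x mem_torus_proj scaled_lattice_eq .
  from someI_ex[OF this]
  show "square_rep r n g \<in> g n" "0 \<le> Re (square_rep r n g)" "Re (square_rep r n g) < real (R_prod r n)"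
    "0 \<le> Im (square_rep r n g)" "Im (square_rep r n g) < real (R_prod r n)"
    unfolding square_rep_def by blast+
qed

lemma coord_square_rep:
  assumes g: "g \<in> carrier (solenoid r)" and n: "n \<ge> 1"
  shows "g n = torus_proj r n (square_rep r n g)"
proof -
  obtain x where x: "g n = torus_proj r n x" using solenoid_coord[OF g n] .
  show ?thesis using square_rep(1)[OF g n] unfolding x
    by (simp add: mem_torus_proj torus_proj_eq_iff gaussian_lattice_commute scaled_lattice_eq)
qed


text \<open>The bonding maps transport the representative at level \<open>m\<close> down to all coarser levels.\<close>

lemma coord_square_rep_le:
  assumes g: "g \<in> carrier (solenoid r)" and n: "1 \<le> n" "n \<le> m"
  shows "g n = torus_proj r n (square_rep r m g)"
proof -
  have "n \<ge> 1 \<longrightarrow> g n = torus_proj r n (square_rep r m g)" using n(2)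
  proof (induction rule: inc_induct)
    case base
    show ?case using coord_square_rep[OF g] by blast
  next
    case (step k)
    show ?case
    proof
      assume k: "k \<ge> 1"
      then have "g k = torus_bond r k (g (Suc k))" using g by (simp add: mem_solenoid)
      then show "g k = torus_proj r k (square_rep r m g)" using step by (simp add: torus_bond_proj)
    qed
  qed
  with n show ?thesis by blast
qed

text \<open>Both coordinates are treated at once as an additive functional \<open>p\<close>. The condition
  \<open>0 < p < t\<close> on the representative is open, since it says that the torus coordinate meets an open strip;
  for \<open>t\<close> equal to the period only the points with \<open>p = 0\<close> are missing, and they form the complement.\<close>

lemma square_rep_measurable:
  assumes n: "n \<ge> 1" shows "square_rep r n \<in> borel_measurable \<rho>"
proof -
  let ?R = "real (R_prod r n)"
  have part: "(\<lambda>g. p (square_rep r n g)) \<in> borel_measurable \<rho>"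
    if cont: "continuous_on UNIV p"
      and lat: "\<And>c. c \<in> scaled_lattice r n \<Longrightarrow> \<exists>a::int. p c = of_int a * ?R"
      and diff: "\<And>z w. p (z - w) = p z - p w"
      and rg: "\<And>g. g \<in> carrier (solenoid r) \<Longrightarrow> 0 \<le> p (square_rep r n g) \<and> p (square_rep r n g) < ?R"
    for p :: "complex \<Rightarrow> real"
    unfolding borel_measurable_iff_less
  proof
    fix c :: real
    define V where "V t = {g \<in> carrier (solenoid r). g n \<inter> {w. 0 < p w \<and> p w < t} \<noteq> {}}" for t
    have Vs: "V t \<in> sets \<rho>" for t
    proof -
      have "open {w. 0 < p w \<and> p w < t}"
        using cont by (intro open_Collect_conj open_Collect_less continuous_intros) auto
      then show ?thesis unfolding V_def by (intro openin_sets openin_solenoid_meets n)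
    qed
    have V: "g \<in> V t \<longleftrightarrow> 0 < p (square_rep r n g) \<and> p (square_rep r n g) < t"
      if g: "g \<in> carrier (solenoid r)" and t: "t \<le> ?R" for g t
    proof
      assume "g \<in> V t"
      then obtain w where w: "w \<in> g n" "0 < p w" "p w < t" by (auto simp: V_def)
      have "w - square_rep r n g \<in> scaled_lattice r n"
        using w(1) coord_square_rep[OF g n] mem_torus_proj by metis
      then obtain a :: int where a: "p w - p (square_rep r n g) = of_int a * ?R" using lat diff by metis
      have Rp: "?R > 0" using R_prod_pos by simp
      have "\<bar>p w - p (square_rep r n g)\<bar> < ?R" using w t rg[OF g] by linarith
      then have "\<bar>of_int a\<bar> * ?R < 1 * ?R" using Rp unfolding a by (simp add: abs_mult)
      then have "\<bar>of_int a :: real\<bar> < 1" using Rp mult_right_less_imp_less[OF _ less_imp_le] by blast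
      then have "a = 0" by linarith
      then have "p w = p (square_rep r n g)" using a by simp
      then show "0 < p (square_rep r n g) \<and> p (square_rep r n g) < t" using w by simp
    next
      assume "0 < p (square_rep r n g) \<and> p (square_rep r n g) < t"
      then show "g \<in> V t" using square_rep(1)[OF g n] g by (auto simp: V_def)
    qed
    show "{g \<in> space \<rho>. p (square_rep r n g) < c} \<in> sets \<rho>"
    proof (cases "c \<le> 0")
      case True
      then have "\<not> p (square_rep r n g) < c" if "g \<in> space \<rho>" for g
        using rg[of g] that by (simp add: space_haar)
      then have "{g \<in> space \<rho>. p (square_rep r n g) < c} = {}" by blast
      then show ?thesis by (metis sets.empty_sets)
    next
      case False
      have "{g \<in> space \<rho>. p (square_rep r n g) < c} = V (min c ?R) \<union> (space \<rho> - V ?R)"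
      proof (intro Set.set_eqI iffI)
        fix g assume "g \<in> {g \<in> space \<rho>. p (square_rep r n g) < c}"
        then show "g \<in> V (min c ?R) \<union> (space \<rho> - V ?R)"
          using rg[of g] V[of g "min c ?R"] V[of g ?R] by (auto simp: space_haar)
      next
        fix g assume g: "g \<in> V (min c ?R) \<union> (space \<rho> - V ?R)"
        then have gc: "g \<in> carrier (solenoid r)" by (auto simp: V_def space_haar)
        then show "g \<in> {g \<in> space \<rho>. p (square_rep r n g) < c}"
          using g rg[of g] V[of g "min c ?R"] V[of g ?R] False by (auto simp: space_haar)
      qed
      then show ?thesis using Vs by auto
    qed
  qed
  have "(\<lambda>g. Re (square_rep r n g)) \<in> borel_measurable \<rho>"
    by (rule part) (auto simp: scaled_lattice_eq gaussian_lattice_iff square_rep[OF _ n] intro: continuous_intros)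
  moreover have "(\<lambda>g. Im (square_rep r n g)) \<in> borel_measurable \<rho>"
    by (rule part) (auto simp: scaled_lattice_eq gaussian_lattice_iff square_rep[OF _ n] intro: continuous_intros)
  ultimately show ?thesis by (simp add: borel_measurable_complex_iff)
qed

text \<open>A basic open neighbourhood of \<open>g\<close> restricts finitely many torus coordinates. All of them are read
  off from one representative at a sufficiently high level, so a cell that is small compared with the
  finitely many radii involved fits between \<open>g\<close> and the open set. As there are countably many cells,
  every open set is a countable union of cells.\<close>

lemma sets_generated:
  assumes N: "N \<ge> 1"
  shows "sets \<rho> = sigma_sets (space \<rho>) (range (\<lambda>(n, a, b). {g \<in> space \<rho>.
     \<lfloor>2 ^ n * Re (square_rep r (N + n) g)\<rfloor> = a \<and> \<lfloor>2 ^ n * Im (square_rep r (N + n) g)\<rfloor> = b}))"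
    (is "_ = sigma_sets _ (range ?C)")
proof
  have meas: "square_rep r (N + n) \<in> borel_measurable \<rho>" for n using N by (intro square_rep_measurable) simp
  have "?C t \<in> sets \<rho>" for t
  proof (cases t)
    case (fields n a b)
    show ?thesis unfolding fields prod.case using meas[of n] by measurable
  qed
  then show "sigma_sets (space \<rho>) (range ?C) \<subseteq> sets \<rho>"
    by (intro sets.sigma_sets_subset) auto
  have "U \<in> sigma_sets (space \<rho>) (range ?C)" if U: "openin (solenoid_topology r) U" for U
  proof -
    have sub: "U \<subseteq> carrier (solenoid r)" using U openin_subset topspace_solenoid by blast
    have "\<exists>t. g \<in> ?C t \<and> ?C t \<subseteq> U" if g: "g \<in> U" for g
    proof -
      have gc: "g \<in> carrier (solenoid r)" using g sub by blast
      obtain T where T: "openin (product_topology (torus_topology r) {1..}) T" "U = T \<inter> carrier (solenoid r)"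
        using U unfolding solenoid_topology_def openin_subtopology by blast
      obtain W where W: "finite {i \<in> {1..}. W i \<noteq> topspace (torus_topology r i)}"
        "\<And>i. i \<ge> 1 \<Longrightarrow> openin (torus_topology r i) (W i)" "g \<in> Pi\<^sub>E {1..} W" "Pi\<^sub>E {1..} W \<subseteq> T"
      proof -
        have "g \<in> T" using g T(2) by blast
        with T(1) show thesis
          unfolding openin_product_topology_alt using that by (elim ballE[where x = g]) auto
      qed
      define J where "J = {i \<in> {1..}. W i \<noteq> topspace (torus_topology r i)}"
      have finJ: "finite J" using W(1) by (simp add: J_def)
      have "\<exists>e>0. ball (square_rep r i g) e \<subseteq> torus_proj r i -` W i" if i: "i \<ge> 1" for i
      proof -
        have "open (torus_proj r i -` W i)" using W(2)[OF i] unfolding openin_torus_topology by simp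
        moreover have "square_rep r i g \<in> torus_proj r i -` W i"
          using W(3) i coord_square_rep[OF gc i] by (auto dest: PiE_mem)
        ultimately show ?thesis using open_contains_ball by blast
      qed
      then obtain e where e: "\<And>i. i \<ge> 1 \<Longrightarrow> e i > (0::real)" "\<And>i. i \<ge> 1 \<Longrightarrow> ball (square_rep r i g) (e i) \<subseteq> torus_proj r i -` W i"
        by metis
      define d where "d = Min (insert 1 (e ` J))"
      have d: "d > 0" "\<And>i. i \<in> J \<Longrightarrow> d \<le> e i"
        using finJ e(1) by (auto simp: d_def J_def)
      obtain k where k: "(1/2::real) ^ k < d / 2" using real_arch_pow_inv[of "d/2" "1/2"] d by auto
      define m where "m = Max (insert k J)"
      have m: "k \<le> m" "\<And>i. i \<in> J \<Longrightarrow> i \<le> m" using finJ by (auto simp: m_def)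
      have "(1/2::real) ^ m \<le> (1/2) ^ k" using m(1) by (intro power_decreasing) auto
      then have md: "2 * (1/2::real) ^ m < d" using k by linarith
      define t where "t = (m, \<lfloor>2 ^ m * Re (square_rep r (N + m) g)\<rfloor>, \<lfloor>2 ^ m * Im (square_rep r (N + m) g)\<rfloor>)"
      have "g \<in> ?C t" using gc by (simp add: t_def space_haar)
      moreover have "?C t \<subseteq> U"
      proof
        fix h assume "h \<in> ?C t"
        then have hc: "h \<in> carrier (solenoid r)"
          and fl: "\<lfloor>2 ^ m * Re (square_rep r (N + m) h)\<rfloor> = \<lfloor>2 ^ m * Re (square_rep r (N + m) g)\<rfloor>"
            "\<lfloor>2 ^ m * Im (square_rep r (N + m) h)\<rfloor> = \<lfloor>2 ^ m * Im (square_rep r (N + m) g)\<rfloor>"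
          by (simp_all add: t_def space_haar)
        define v where "v = square_rep r (N + m) h - square_rep r (N + m) g"
        have close: "\<bar>x - y\<bar> < (1/2) ^ m" if "\<lfloor>2 ^ m * x\<rfloor> = \<lfloor>2 ^ m * y\<rfloor>" for x y :: real
        proof -
          have "\<bar>2 ^ m * x - 2 ^ m * y\<bar> < 1" using that by linarith
          also have "\<bar>2 ^ m * x - 2 ^ m * y\<bar> = 2 ^ m * \<bar>x - y\<bar>"
            by (simp add: abs_mult flip: right_diff_distrib)
          finally show ?thesis by (simp add: power_one_over field_simps)
        qed
        have "norm v < d"
          using cmod_le[of v] close[OF fl(1)] close[OF fl(2)] md by (simp add: v_def)
        have "h i \<in> W i" if i: "i \<ge> 1" for i
        proof (cases "i \<in> J")
          case True
          have im: "i \<le> N + m" using m(2)[OF True] by simp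
          have "square_rep r i g + v \<in> ball (square_rep r i g) (e i)"
            using \<open>norm v < d\<close> d(2)[OF True] by (simp add: dist_norm)
          then have "torus_proj r i (square_rep r i g + v) \<in> W i" using e(2)[OF i] by blast
          moreover have "torus_proj r i (square_rep r i g) = torus_proj r i (square_rep r (N + m) g)"
            using coord_square_rep[OF gc i] coord_square_rep_le[OF gc i im] by simp
          then have "torus_proj r i (square_rep r i g + v) = torus_proj r i (square_rep r (N + m) g + v)"
            unfolding torus_proj_eq_iff by simp
          ultimately show ?thesis using coord_square_rep_le[OF hc i im] by (simp add: v_def)
        next
          case False
          then have "W i = range (torus_proj r i)" using i by (simp add: J_def topspace_torus)
          moreover have "h i \<in> range (torus_proj r i)" by (rule solenoid_coord[OF hc i]) simp
          ultimately show ?thesis by simp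
        qed
        then have "h \<in> Pi\<^sub>E {1..} W" using solenoid_extensional[OF hc] by (auto simp: PiE_def)
        then show "h \<in> U" using W(4) hc unfolding T(2) by blast
      qed
      ultimately show ?thesis by blast
    qed
    then have "\<exists>t. \<forall>g\<in>U. g \<in> ?C (t g) \<and> ?C (t g) \<subseteq> U" by (intro bchoice ballI)
    then obtain t where t: "\<forall>g\<in>U. g \<in> ?C (t g) \<and> ?C (t g) \<subseteq> U" by (elim exE)
    have "U = \<Union> (?C ` t ` U)"
    proof (intro equalityI subsetI)
      fix g assume "g \<in> U"
      then show "g \<in> \<Union> (?C ` t ` U)" using bspec[OF t, of g] by (intro UnionI[of "?C (t g)"] imageI; simp)
    next
      fix g assume "g \<in> \<Union> (?C ` t ` U)"
      then obtain h where "h \<in> U" "g \<in> ?C (t h)" by (elim UnionE imageE) simp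
      then show "g \<in> U" using bspec[OF t, of h] subsetD[of "?C (t h)" U g] by simp
    qed
    moreover have "\<Union> (?C ` t ` U) \<in> sigma_sets (space \<rho>) (range ?C)"
      by (intro sigma_sets_UNION countable_image[OF countableI_type]) (auto intro!: sigma_sets.Basic)
    ultimately show ?thesis by simp
  qed
  then show "sets \<rho> \<subseteq> sigma_sets (space \<rho>) (range ?C)"
    unfolding sets_haar space_haar[symmetric] by (intro sigma_sets_mono) auto
qed

lemma solenoidal_flow:
  assumes N: "N \<ge> 1"
  shows "solenoidal_flow \<rho> (solenoid_act r) (\<lambda>n. R_prod r (N + n)) (\<lambda>n. square_rep r (N + n))"
proof -
  interpret prob_space \<rho> by (rule prob_space_haar)
  have Nn: "1 \<le> N + n" for n using N by simp
  show ?thesis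
  proof
    fix n g z assume g: "g \<in> space \<rho>"
    then have gc: "g \<in> carrier (solenoid r)" by (simp add: space_haar)
    have "square_rep r (N + n) (solenoid_act r z g) \<in> torus_proj r (N + n) (square_rep r (N + n) g + z)"
      using square_rep(1)[OF solenoid_act_carrier[OF gc] Nn] solenoid_act_coord[where g = g, OF Nn coord_square_rep[OF gc Nn]] by simp
    then show "square_rep r (N + n) (solenoid_act r z g) - (square_rep r (N + n) g + z) \<in> gaussian_lattice (R_prod r (N + n))"
      by (simp add: mem_torus_proj scaled_lattice_eq)
    have "square_rep r (N + n) g \<in> torus_proj r (N + n) (square_rep r (N + Suc n) g)"
      using square_rep(1)[OF gc Nn, of n] coord_square_rep_le[OF gc Nn, of n "N + Suc n"] by simp
    then show "square_rep r (N + Suc n) g - square_rep r (N + n) g \<in> gaussian_lattice (R_prod r (N + n))"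
      by (simp add: mem_torus_proj scaled_lattice_eq gaussian_lattice_commute)
  next
    show "R_prod r (N + n) > 0" for n by (rule R_prod_pos)
    show "R_prod r (N + n) dvd R_prod r (N + Suc n)" for n by (rule R_prod_dvd) simp
    show "solenoid_act r z \<in> measurable \<rho> \<rho>" for z by (rule act_measurable)
    show "distr \<rho> \<rho> (solenoid_act r z) = \<rho>" for z by (rule act_preserving)
    show "solenoid_act r w (solenoid_act r z g) = solenoid_act r (w + z) g" if "g \<in> space \<rho>" for w z g
      using that by (intro solenoid_act_act) (simp add: space_haar)
    show "square_rep r (N + n) \<in> borel_measurable \<rho>" for n by (rule square_rep_measurable[OF Nn])
    show "0 \<le> Re (square_rep r (N + n) g) \<and> Re (square_rep r (N + n) g) < real (R_prod r (N + n)) \<and>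
        0 \<le> Im (square_rep r (N + n) g) \<and> Im (square_rep r (N + n) g) < real (R_prod r (N + n))"
      if "g \<in> space \<rho>" for n g
      using square_rep[OF _ Nn, of g n] that by (simp add: space_haar)
    show "sets \<rho> = sigma_sets (space \<rho>) (range (\<lambda>(n, a, b). {g \<in> space \<rho>.
       \<lfloor>2 ^ n * Re (square_rep r (N + n) g)\<rfloor> = a \<and> \<lfloor>2 ^ n * Im (square_rep r (N + n) g)\<rfloor> = b}))"
      by (rule sets_generated[OF N])
  qed
qed

end

text \<open>Since \<open>1 / r\<^sub>n\<close> tends to 0, from some index \<open>N\<close> on the factors are at least 4; the flow is built on
  the levels from \<open>N\<close> on, which determine the earlier ones.\<close>

theorem theorem2p3:
  fixes r :: "nat \<Rightarrow> nat" and \<rho> :: "(nat \<Rightarrow> complex set) measure"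
  assumes r_pos: "\<And>n. n \<ge> 1 \<Longrightarrow> r n > 0"
    and r_sum: "summable (\<lambda>n. 1 / real (r (Suc n)))"
    and haar: "haar_probability (solenoid r) (solenoid_topology r) \<rho>"
  shows "\<exists>F \<in> borel_measurable \<rho>.
           (AE g in \<rho>. orbit_map r F g \<in> universal_entire) \<and>
           (\<exists>\<mu>. is_pushforward_ae \<rho> entire_borel (orbit_map r F) \<mu> \<and>
                ergodic_measure \<mu> \<and> (AE f in \<mu>. f \<in> universal_entire))"
proof -
  interpret solenoid_haar r \<rho> using r_pos haar by unfold_locales
  have "(\<lambda>n. 1 / real (r (Suc n))) \<longlonglongrightarrow> 0" by (rule summable_LIMSEQ_zero[OF r_sum])
  then have "\<forall>\<^sub>F n in sequentially. 1 / real (r (Suc n)) < 1/4" by (rule order_tendstoD(2)) simp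
  then obtain N0 where N0: "\<And>n. n \<ge> N0 \<Longrightarrow> 1 / real (r (Suc n)) < 1/4"
    unfolding eventually_sequentially by blast
  define N where "N = Suc N0"
  have r4: "4 \<le> r (Suc (N + n))" for n
    using N0[of "N + n"] r_pos[of "Suc (N + n)"] by (simp add: N_def field_simps)
  interpret solenoidal_flow \<rho> "solenoid_act r" "\<lambda>n. R_prod r (N + n)" "\<lambda>n. square_rep r (N + n)"
    by (rule solenoidal_flow) (simp add: N_def)
  have growth: "4 * R_prod r (N + n) \<le> R_prod r (N + Suc n)" for n
    using r4[of n] by (simp add: R_prod_Suc)
  have "real (R_prod r (N + n)) / real (R_prod r (N + Suc n)) = 1 / real (r (Suc (n + N)))" for n
    using R_prod_pos[of "N + n"] by (simp add: R_prod_Suc add.commute)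
  then have "summable (\<lambda>n. real (R_prod r (N + n)) / real (R_prod r (N + Suc n)))"
    using summable_ignore_initial_segment[OF r_sum, of N] by simp
  from universal_orbit_function[OF growth this] show ?thesis
    unfolding orbit_map_def solenoid_act_def by simp
qed

end
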